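(* Let $k,n$ be integers with $2\le k\le n-2$. Then the Ehrhart polynomial $i(\mathrm{Sp}_{k,n},t)$ has positive coefficients, and coefficient-wise $$i(T_{k,n},t)\le i(\mathrm{Sp}_{k,n},t)\le i(U_{k,n},t),$$ i.e. for every $m\ge0$ the coefficient of $t^m$ in $i(\mathrm{Sp}_{k,n},t)$ lies between the coefficients of $t^m$ in $i(T_{k,n},t)$ and in $i(U_{k,n},t)$.
   Context: For $S,T\subseteq[n]$, write $T\le S$ if $|T|=|S|$ and the $i$-th smallest element of $T$ is at most the $i$-th smallest element of $S$ for each $i$. The Schubert matroid $\mathrm{SM}_n(S)$ is the matroid on $[n]$ with bases $\{T\subseteq[n]:T\le S\}$. For a matroid $M$ on $[n]$, $i(M,t)$ is the Ehrhart polynomial of its matroid polytope $\mathrm{conv}\{\sum_{b\in B}e_b: B \text{ a basis}\}$ (number of lattice points in the $t$-th dilate). $U_{k,n}=\mathrm{SM}_n(\{n-k+1,\dots,n\})$ is the uniform matroid; $T_{k,n}=\mathrm{SM}_n(\{2,3,\dots,k,n\})$ is the minimal matroid; $\mathrm{Sp}_{k,n}=\mathrm{SM}_n(\{k\}\cup\{k+2,k+3,\dots,n\})$ (indicator vector $(0^{k-1},1,0,1^{n-k-1})$). *)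

theory Defs
  imports Complex_Main "HOL-Computational_Algebra.Polynomial"
begin

definition gale_le :: "nat set \<Rightarrow> nat set \<Rightarrow> bool" where
  "gale_le T S \<longleftrightarrow> finite T \<and> finite S \<and> card T = card S \<and>
     (\<forall>i < card S. sorted_list_of_set T ! i \<le> sorted_list_of_set S ! i)"

definition schubert_bases :: "nat \<Rightarrow> nat set \<Rightarrow> nat set set" where
  "schubert_bases n S = {T. T \<subseteq> {1..n} \<and> gale_le T S}"

(* Lattice points of the t-th dilate of the matroid polytope
   conv{ e_B : B basis } \<subseteq> R^n (coordinates indexed by 1..n).
   A point lies in t * conv(V) iff it is a nonnegative combination of the
   vertices with total weight t (convex hull written out). *)
definition dilate_lattice_points :: "nat \<Rightarrow> nat set set \<Rightarrow> nat \<Rightarrow> (nat \<Rightarrow> int) set" where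
  "dilate_lattice_points n \<B> t =
     {x. (\<forall>i. i \<notin> {1..n} \<longrightarrow> x i = 0) \<and>
         (\<exists>c :: nat set \<Rightarrow> real.
            (\<forall>B\<in>\<B>. c B \<ge> 0) \<and> (\<Sum>B\<in>\<B>. c B) = real t \<and>
            (\<forall>i\<in>{1..n}. real_of_int (x i) = (\<Sum>B\<in>\<B>. (if i \<in> B then c B else 0))))}"

definition ehrhart_poly :: "nat \<Rightarrow> nat set set \<Rightarrow> real poly" where
  "ehrhart_poly n \<B> =
     (THE p. \<forall>t::nat. poly p (real t) = real (card (dilate_lattice_points n \<B> t)))"

definition uniform_set :: "nat \<Rightarrow> nat \<Rightarrow> nat set" where
  "uniform_set k n = {n - k + 1..n}"

definition minimal_set :: "nat \<Rightarrow> nat \<Rightarrow> nat set" where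
  "minimal_set k n = {2..k} \<union> {n}"

definition sp_set :: "nat \<Rightarrow> nat \<Rightarrow> nat set" where
  "sp_set k n = {k} \<union> {k+2..n}"

end

theory Submission
  imports Defs "HOL-Computational_Algebra.Polynomial_FPS"
begin

text \<open>
  All three matroids have bases of the form \<open>{T. card T = r \<and> c \<le> card (T \<inter> {1..k})}\<close>, and lattice points of
  the dilates are described by the corresponding linear inequalities. Splitting coordinates at \<open>k\<close> gives
  \<open>i(T, t) = (\<Sum>u\<le>t. C(u + k - 1, u) C(u + n - k - 1, u))\<close> and \<open>i(Sp, t) = i(U, t) - i(T, t - 1)\<close>, so the
  essential claim is that \<open>i(U, t) \<ge> i(T, t) + i(T, t - 1)\<close> coefficientwise.

  Write \<open>q = 1 / ((1 - y) (1 - s y))\<close> and \<open>L = ln ((1 - s y) / (1 - y)) / (1 - s)\<close>. For \<open>m \<ge> 1\<close> the coefficients of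
  \<open>t ^ m\<close> in \<open>i(U, t)\<close>, \<open>i(T, t)\<close> and \<open>i(T, t - 1)\<close> are those of \<open>y ^ (n - 1) s ^ (k - 1)\<close> in \<open>A_m(s) L ^ m q / m!\<close> with the
  Eulerian polynomial \<open>A_m\<close>, in \<open>q R (ln q) ^ (m - 1) / m!\<close> and in \<open>R (ln q) ^ (m - 1) / m!\<close>, where
  \<open>R = ln q / (1 + s - s y)\<close> has the coefficients \<open>1 / (N C(N - 1, j))\<close>. All these series have nonnegative
  coefficients, and the claim follows from \<open>ln q \<le> (1 + s) L\<close>, from
  \<open>A_m \<ge> 2 (1 + s) ^ (m - 1) - 1 - s ^ (m - 1)\<close> and from an estimate of \<open>(1 + q) R\<close> by harmonic sums, which is
  the case \<open>m = 1\<close>.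
\<close>

unbundle fps_syntax

section \<open>Generating series\<close>

text \<open>Series in \<open>y\<close> (that is, \<^term>\<open>fps_X\<close>) over polynomials in \<open>s\<close>. In closed form,
  \<open>log_y = -ln (1 - y)\<close>, \<open>log_sy = -ln (1 - s y)\<close>, \<open>qser = 1 / ((1 - y) (1 - s y))\<close>,
  \<open>lser = ln qser\<close>, \<open>lam = (log_y - log_sy) / (1 - s)\<close>, \<open>rser = lser / (1 + s - s y)\<close> and
  \<open>gser = (1 - s y) / (1 - y)\<close>. The constant coefficients of the logarithms are \<open>1 / 0 = 0\<close>.\<close>

abbreviation svar :: "real poly fps" where "svar \<equiv> fps_const [:0, 1:]"

definition geo_y :: "real poly fps" where "geo_y = Abs_fps (\<lambda>n. 1)"
definition geo_sy :: "real poly fps" where "geo_sy = Abs_fps (\<lambda>n. monom 1 n)"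
definition log_y :: "real poly fps" where "log_y = Abs_fps (\<lambda>n. [:1 / real n:])"
definition log_sy_div :: "real poly fps" where
  "log_sy_div = Abs_fps (\<lambda>n. monom (1 / real n) (n - 1))"
definition lam :: "real poly fps" where
  "lam = Abs_fps (\<lambda>n. \<Sum>j<n. monom (1 / real n) j)"
definition rser :: "real poly fps" where
  "rser = Abs_fps (\<lambda>n. \<Sum>j<n. monom (1 / (real n * real ((n - 1) choose j))) j)"
abbreviation log_sy :: "real poly fps" where "log_sy \<equiv> svar * log_sy_div"
abbreviation qser :: "real poly fps" where "qser \<equiv> geo_y * geo_sy"
abbreviation lser :: "real poly fps" where "lser \<equiv> log_y + log_sy"

section \<open>Closed forms, functional equations and derivatives of the series\<close>

lemma coeff_svar_mult: "coeff ((svar * f) $ n) j = (if j = 0 then 0 else coeff (f $ n) (j - 1))"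
  by (cases j) (simp_all add: coeff_pCons)

lemma geo_y_inverse: "(1 - fps_X) * geo_y = 1"
  by (rule fps_ext) (simp add: geo_y_def algebra_simps)

lemma geo_sy_inverse: "(1 - svar * fps_X) * geo_sy = 1"
proof (rule fps_ext)
  fix n
  show "((1 - svar * fps_X) * geo_sy) $ n = 1 $ n"
    by (cases n) (simp_all add: geo_sy_def algebra_simps mult.assoc monom_Suc monom_altdef)
qed

lemma deriv_geo_y: "fps_deriv geo_y = geo_y * geo_y"
proof -
  have "fps_deriv ((1 - fps_X) * geo_y) = 0" by (simp add: geo_y_inverse)
  hence "(1 - fps_X) * fps_deriv geo_y = geo_y" by (simp add: algebra_simps)
  hence "((1 - fps_X) * fps_deriv geo_y) * geo_y = geo_y * geo_y" by simp
  hence "((1 - fps_X) * geo_y) * fps_deriv geo_y = geo_y * geo_y" by (simp only: ac_simps)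
  thus ?thesis by (simp add: geo_y_inverse)
qed

lemma deriv_geo_sy: "fps_deriv geo_sy = svar * geo_sy * geo_sy"
proof -
  have "fps_deriv ((1 - svar * fps_X) * geo_sy) = 0" by (simp add: geo_sy_inverse)
  hence "(1 - svar * fps_X) * fps_deriv geo_sy = svar * geo_sy" by (simp add: algebra_simps)
  hence "((1 - svar * fps_X) * fps_deriv geo_sy) * geo_sy = svar * geo_sy * geo_sy" by simp
  hence "((1 - svar * fps_X) * geo_sy) * fps_deriv geo_sy = svar * geo_sy * geo_sy" by (simp only: ac_simps)
  thus ?thesis by (simp add: geo_sy_inverse)
qed

lemma deriv_log_y: "fps_deriv log_y = geo_y"
  by (rule fps_ext) (simp add: log_y_def geo_y_def of_nat_poly one_pCons add_divide_distrib[symmetric] del: of_nat_Suc)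

lemma deriv_log_sy: "fps_deriv log_sy = svar * geo_sy"
proof -
  have "fps_deriv log_sy_div = geo_sy"
    by (rule fps_ext) (simp add: log_sy_div_def geo_sy_def of_nat_poly smult_monom del: of_nat_Suc)
  thus ?thesis by simp
qed

lemma qser_nth: "qser $ n = (\<Sum>j\<le>n. monom 1 j)"
  by (simp add: fps_mult_nth geo_y_def geo_sy_def) (rule sum.reindex_bij_witness[of _ "\<lambda>j. n - j" "\<lambda>j. n - j"], auto)

lemma coeff_qser: "coeff (qser $ n) j = (if j \<le> n then 1 else 0)"
  by (simp add: qser_nth coeff_sum)

lemma coeff_lam: "coeff (lam $ n) j = (if j < n then 1 / real n else 0)"
  by (simp add: lam_def coeff_sum)

lemma coeff_log_y: "coeff (log_y $ n) j = (if j = 0 then 1 / real n else 0)"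
  by (cases j) (simp_all add: log_y_def)

lemma coeff_log_sy_div: "coeff (log_sy_div $ n) j = (if Suc j = n then 1 / real n else 0)"
  by (cases n) (simp_all add: log_sy_div_def)

lemma coeff_log_sy: "coeff (log_sy $ n) j = (if j = n then 1 / real n else 0)"
  unfolding coeff_svar_mult coeff_log_sy_div by (cases j; cases n) auto

lemma coeff_rser: "coeff (rser $ n) j = (if j < n then 1 / (real n * real ((n - 1) choose j)) else 0)"
  by (simp add: rser_def coeff_sum)

lemma one_minus_s_lam: "(1 - svar) * lam = log_y - log_sy"
proof (rule fps_ext, rule poly_eqI)
  fix n j
  have "coeff (((1 - svar) * lam) $ n) j = coeff (lam $ n) j - coeff ((svar * lam) $ n) j"
    by (simp add: left_diff_distrib)
  also have "\<dots> = coeff (log_y $ n) j - coeff (log_sy $ n) j"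
    unfolding coeff_log_y coeff_svar_mult coeff_lam by (auto simp: coeff_log_sy_div)
  finally show "coeff (((1 - svar) * lam) $ n) j = coeff ((log_y - log_sy) $ n) j" by simp
qed

text \<open>The recurrence of the Leibniz harmonic triangle, whose entries are the coefficients of
  \<open>rser\<close>; it makes the mixed coefficients cancel in
  \<open>rser_functional\<close>.\<close>

lemma inverse_binomial_pascal:
  assumes "1 \<le> j" "j < n"
  shows "1 / (real n * real ((n - 1) choose j)) + 1 / (real n * real ((n - 1) choose (j - 1)))
     = 1 / (real (n - 1) * real ((n - 2) choose (j - 1)))"
proof -
  obtain i d where ij: "j = Suc i" "n = Suc (Suc (i + d))"
    using assms by (metis Suc_le_D One_nat_def less_iff_Suc_add add_Suc)
  have A: "real (Suc (i + d) choose Suc i) = fact (Suc (i+d)) / (fact (Suc i) * fact d)"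
    by (subst binomial_fact) auto
  have B: "real (Suc (i + d) choose i) = fact (Suc (i+d)) / (fact i * fact (Suc d))"
    by (subst binomial_fact) (auto simp: Suc_diff_le)
  have C: "real ((i + d) choose i) = fact (i+d) / (fact i * fact d)"
    by (subst binomial_fact) auto
  have e: "n - 1 = Suc (i + d)" "n - 2 = i + d" "j - 1 = i" using ij by auto
  show ?thesis unfolding e unfolding ij A B C
    by (simp add: divide_simps) (simp add: algebra_simps)
qed

lemma rser_functional: "(1 + svar - svar * fps_X) * rser = lser"
proof (rule fps_ext, rule poly_eqI)
  fix n j
  have "coeff (((1 + svar - svar * fps_X) * rser) $ n) j
      = coeff (rser $ n) j + coeff ((svar * rser) $ n) j - coeff ((svar * (fps_X * rser)) $ n) j"
    by (simp add: algebra_simps)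
  also have "\<dots> = coeff (log_y $ n) j + coeff (log_sy $ n) j"
  proof (cases n)
    case 0
    then show ?thesis unfolding coeff_log_y coeff_svar_mult by (simp add: coeff_rser coeff_log_sy_div)
  next
    case (Suc m)
    show ?thesis
    proof (cases "1 \<le> j \<and> j < n")
      case True
      then show ?thesis using inverse_binomial_pascal[of j n] Suc
        unfolding coeff_log_y coeff_svar_mult by (auto simp: coeff_rser coeff_log_sy_div)
    next
      case False
      \<comment> \<open>On the two borders a single entry \<open>1 / n\<close> of the triangle
        survives; these entries are the coefficients of \<open>log_y\<close> and
        \<open>log_sy\<close>.\<close>
      hence "j = 0 \<or> j = n \<or> j > n" by auto
      then show ?thesis using Suc
        unfolding coeff_log_y coeff_svar_mult by (auto simp: coeff_rser coeff_log_sy_div)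
    qed
  qed
  finally show "coeff (((1 + svar - svar * fps_X) * rser) $ n) j = coeff (lser $ n) j" by simp
qed

lemma deriv_lser: "fps_deriv lser = geo_y + svar * geo_sy"
  by (simp only: fps_deriv_add deriv_log_y deriv_log_sy)

text \<open>The differential form of \<open>qser = exp lser\<close>, as
  \<open>exp_series_nth\<close> requires it; \<open>deriv_gser\<close> is its analogue for
  \<open>gser\<close> and \<open>log_y - log_sy\<close>.\<close>

lemma deriv_qser: "fps_deriv qser = fps_deriv lser * qser"
  unfolding deriv_lser by (simp add: deriv_geo_y deriv_geo_sy algebra_simps)

definition gser :: "real poly fps" where "gser = (1 - svar * fps_X) * geo_y"

lemma deriv_gser: "fps_deriv gser = fps_deriv (log_y - log_sy) * gser"
proof -
  have "fps_deriv (log_y - log_sy) * gser = (geo_y - svar * geo_sy) * ((1 - svar * fps_X) * geo_y)"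
    by (simp only: fps_deriv_sub deriv_log_y deriv_log_sy gser_def)
  also have "\<dots> = (1 - svar * fps_X) * geo_y * geo_y - svar * ((1 - svar * fps_X) * geo_sy) * geo_y"
    by (simp add: algebra_simps)
  also have "\<dots> = fps_deriv gser"
    unfolding geo_sy_inverse by (simp add: gser_def deriv_geo_y algebra_simps)
  finally show ?thesis by simp
qed

section \<open>The hypersimplex coefficients\<close>

lemma smult_sum_right: "smult c (\<Sum>i\<in>A. f i) = (\<Sum>i\<in>A. smult c (f i))"
  by (induction A rule: infinite_finite_induct) (simp_all add: smult_add_right)

text \<open>The hypotheses say \<open>g = exp f\<close>, so \<open>g ^ t\<close> is the exponential
  of \<open>t f\<close>. As \<open>f\<close> has no constant term, \<open>f ^ m\<close> starts at
  order \<open>m\<close>, and terms with \<open>m > N\<close> cannot reach the coefficient of index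
  \<open>N\<close>.\<close>

lemma exp_series_nth:
  fixes f g :: "real poly fps"
  assumes f0: "f $ 0 = 0" and g0: "g $ 0 = 1" and ode: "fps_deriv g = fps_deriv f * g" and "N \<le> M"
  shows "(\<Sum>m\<le>M. smult (real t ^ m / fact m) ((f ^ m) $ N)) = (g ^ t) $ N"
proof -
  \<comment> \<open>Truncated exponentials of \<open>t f\<close>. Differentiation lowers the cut-off
    by one, which matches the order lost in comparing coefficients with
    \<open>g ^ t\<close>.\<close>
  define E where "E M = (\<Sum>m\<le>M. fps_const [:real t ^ m / fact m:] * f ^ m)" for M
  have E_deriv: "fps_deriv (E (Suc M)) = of_nat t * fps_deriv f * E M" for M
  proof -
    have "fps_deriv (E (Suc M)) = (\<Sum>m\<le>Suc M. fps_const [:real t ^ m / fact m:] * (of_nat m * fps_deriv f * f ^ (m - 1)))"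
      unfolding E_def fps_deriv_sum by (rule sum.cong) (simp_all add: fps_deriv_power fps_of_nat)
    also have "\<dots> = (\<Sum>m\<le>M. fps_const [:real t ^ Suc m / fact (Suc m):] * (of_nat (Suc m) * fps_deriv f * f ^ m))"
      by (subst sum.atMost_Suc_shift) simp
    also have "\<dots> = (\<Sum>m\<le>M. of_nat t * fps_deriv f * (fps_const [:real t ^ m / fact m:] * f ^ m))"
    proof (rule sum.cong[OF refl])
      fix m
      have "fps_const [:real t ^ Suc m / fact (Suc m):] * of_nat (Suc m) = of_nat t * fps_const [:real t ^ m / fact m:]"
        by (simp add: fps_of_nat[symmetric] of_nat_poly del: of_nat_Suc)
      thus "fps_const [:real t ^ Suc m / fact (Suc m):] * (of_nat (Suc m) * fps_deriv f * f ^ m)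
        = of_nat t * fps_deriv f * (fps_const [:real t ^ m / fact m:] * f ^ m)"
        by (metis (no_types, lifting) mult.assoc mult.commute)
    qed
    also have "\<dots> = of_nat t * fps_deriv f * E M"
      by (simp add: E_def sum_distrib_left)
    finally show ?thesis .
  qed
  have g_deriv: "fps_deriv (g ^ t) = of_nat t * fps_deriv f * g ^ t"
    by (cases t) (simp_all add: fps_deriv_power' ode mult_ac del: of_nat_Suc power_Suc, simp add: mult_ac)
  have "\<forall>N\<le>M. E M $ N = (g ^ t) $ N" for M
  proof (induction M)
    case 0
    then show ?case by (simp add: E_def g0 fps_nth_power_0 one_pCons[symmetric])
  next
    case (Suc M)
    show ?case
    proof (intro allI impI)
      fix N assume N: "N \<le> Suc M"
      show "E (Suc M) $ N = (g ^ t) $ N"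
      proof (cases N)
        case 0
        have "E (Suc M) $ 0 = (\<Sum>m\<le>Suc M. if m = 0 then 1 else 0)"
          unfolding E_def fps_sum_nth
          by (rule sum.cong) (auto simp: fps_nth_power_0 f0 one_pCons)
        then show ?thesis using 0 by (simp add: g0 fps_nth_power_0)
      next
        case (Suc N')
        have "of_nat (Suc N') * E (Suc M) $ N = (of_nat t * fps_deriv f * E M) $ N'"
          unfolding E_deriv[symmetric] Suc by simp
        also have "\<dots> = (of_nat t * fps_deriv f * g ^ t) $ N'"
          unfolding fps_mult_nth[of _ "E M"] fps_mult_nth[of _ "g ^ t"]
          using Suc.IH N Suc by (intro sum.cong) auto
        also have "\<dots> = of_nat (Suc N') * (g ^ t) $ N"
          unfolding g_deriv[symmetric] Suc by simp
        finally show ?thesis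
          by (metis mult_left_cancel nat.distinct(1) of_nat_eq_0_iff)
      qed
    qed
  qed
  hence "E M $ N = (g ^ t) $ N" using \<open>N \<le> M\<close> by blast
  thus ?thesis by (simp add: E_def fps_sum_nth)
qed

lemma exp_series_mult_nth:
  fixes f g h :: "real poly fps"
  assumes "f $ 0 = 0" "g $ 0 = 1" "fps_deriv g = fps_deriv f * g" "N \<le> M"
  shows "(\<Sum>m\<le>M. smult (real t ^ m / fact m) ((f ^ m * h) $ N)) = (g ^ t * h) $ N"
proof -
  have "(\<Sum>m\<le>M. smult (real t ^ m / fact m) ((f ^ m * h) $ N))
     = (\<Sum>m\<le>M. \<Sum>i=0..N. smult (real t ^ m / fact m) ((f ^ m) $ i) * h $ (N - i))"
    by (simp add: fps_mult_nth smult_sum_right)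
  also have "\<dots> = (\<Sum>i=0..N. (\<Sum>m\<le>M. smult (real t ^ m / fact m) ((f ^ m) $ i)) * h $ (N - i))"
    by (subst sum.swap) (simp only: sum_distrib_right)
  also have "\<dots> = (\<Sum>i=0..N. (g ^ t) $ i * h $ (N - i))"
    using assms by (intro sum.cong refl) (subst exp_series_nth, auto)
  finally show ?thesis by (simp add: fps_mult_nth)
qed

section \<open>Coefficients of powers of \<open>qser\<close> and \<open>gser\<close>\<close>

lemma geometric_power_nth:
  "((Abs_fps (\<lambda>n. 1 :: 'a :: comm_ring_1)) ^ Suc u) $ n = of_nat (n + u choose u)"
proof (induction u arbitrary: n)
  case (Suc u)
  have "((Abs_fps (\<lambda>n. 1 :: 'a)) ^ Suc (Suc u)) $ n = (\<Sum>i=0..n. ((Abs_fps (\<lambda>n. 1 :: 'a)) ^ Suc u) $ i)"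
    unfolding power_Suc2[of _ "Suc u"] fps_mult_nth by simp
  also have "\<dots> = of_nat (\<Sum>i\<le>n. u + i choose u)"
    unfolding Suc.IH by (simp add: atMost_atLeast0 add.commute)
  also have "\<dots> = of_nat (n + Suc u choose Suc u)"
    by (subst choose_rising_sum(1)) (simp add: add.commute)
  finally show ?case .
qed simp

lemma geo_y_power_nth: "(geo_y ^ Suc u) $ n = of_nat (n + u choose u)"
  unfolding geo_y_def by (rule geometric_power_nth)

lemma geo_sy_power_nth: "(geo_sy ^ Suc u) $ n = monom (real (n + u choose u)) n"
proof (induction u arbitrary: n)
  case 0
  then show ?case by (simp add: geo_sy_def)
next
  case (Suc u)
  have "(geo_sy ^ Suc (Suc u)) $ n = (\<Sum>i=0..n. (geo_sy ^ Suc u) $ i * monom 1 (n - i))"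
    unfolding power_Suc2[of _ "Suc u"] fps_mult_nth by (simp add: geo_sy_def)
  also have "\<dots> = (\<Sum>i=0..n. monom (real (i + u choose u)) n)"
    unfolding Suc.IH by (intro sum.cong refl) (simp add: mult_monom)
  also have "\<dots> = monom (\<Sum>i=0..n. real (i + u choose u)) n"
    by (rule poly_eqI) (simp add: coeff_sum)
  also have "(\<Sum>i=0..n. real (i + u choose u)) = real (\<Sum>i\<le>n. u + i choose u)"
    by (simp add: atMost_atLeast0 add.commute)
  also have "\<dots> = real (n + Suc u choose Suc u)"
    by (subst choose_rising_sum(1)) (simp add: add.commute)
  finally show ?case .
qed

lemma coeff_qser_power:
  "coeff ((qser ^ Suc u) $ n) j = (if j \<le> n then real (j + u choose u) * real (n - j + u choose u) else 0)"
proof -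
  have "(qser ^ Suc u) $ n = (geo_sy ^ Suc u * geo_y ^ Suc u) $ n"
    by (simp only: power_mult_distrib mult.commute)
  also have "\<dots> = (\<Sum>i=0..n. monom (real (i + u choose u)) i * [:real (n - i + u choose u):])"
    by (simp only: fps_mult_nth geo_sy_power_nth geo_y_power_nth of_nat_poly)
  finally show ?thesis
    by (auto simp: coeff_sum mult.commute if_distrib[of "\<lambda>x. x * _"] if_distrib[of "\<lambda>x. _ * x"] cong: if_cong)
qed

lemma one_minus_sy_power_nth:
  "((1 - svar * fps_X) ^ w) $ n = monom ((-1) ^ n * real (w choose n)) n"
proof (induction w arbitrary: n)
  case 0
  show ?case by (cases n) (simp_all)
next
  case (Suc w)
  have "((1 - svar * fps_X) ^ Suc w) $ n = ((1 - svar * fps_X) ^ w) $ n - [:0,1:] * (fps_X * (1 - svar * fps_X) ^ w) $ n"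
    by (simp only: power_Suc left_diff_distrib mult_1_left fps_sub_nth mult.assoc fps_mult_left_const_nth)
  also have "\<dots> = monom ((-1) ^ n * real (Suc w choose n)) n"
  proof (rule poly_eqI, cases n)
    fix i assume "n = 0"
    thus "coeff (((1 - svar * fps_X) ^ w) $ n - [:0,1:] * (fps_X * (1 - svar * fps_X) ^ w) $ n) i
       = coeff (monom ((-1) ^ n * real (Suc w choose n)) n) i"
      by (simp only: Suc.IH fps_X_mult_nth if_True) simp
  next
    fix i k assume n: "n = Suc k"
    have "(fps_X * (1 - svar * fps_X) ^ w) $ n = monom ((-1) ^ k * real (w choose k)) k"
      by (simp only: Suc.IH n fps_X_mult_nth) simp
    thus "coeff (((1 - svar * fps_X) ^ w) $ n - [:0,1:] * (fps_X * (1 - svar * fps_X) ^ w) $ n) i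
       = coeff (monom ((-1) ^ n * real (Suc w choose n)) n) i"
      by (cases i) (simp_all only: Suc.IH n, auto simp: coeff_pCons algebra_simps)
  qed
  finally show ?case .
qed

text \<open>Adds the two neighbouring coefficients that multiplication by \<open>1 - s\<close>
  combines in \<open>coeff_gser_power\<close>. For \<open>j \<le> w\<close> it is a rational
  identity between factorials; at \<open>j = Suc w\<close> one term on the left remains, and beyond
  that both sides vanish.\<close>

lemma binomial_relation:
  assumes "1 \<le> j" "j \<le> N"
  shows "(w choose j) * (N - j + Suc w choose Suc w) + (w choose (j - 1)) * (N - (j - 1) + Suc w choose Suc w)
       = (Suc N choose j) * (if j \<le> Suc w then (Suc w - j + N) choose N else 0)"
proof -
  \<comment> \<open>The offsets turn all subtractions into sums, so that the factorials can be
    unfolded.\<close>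
  obtain i e where ie: "j = Suc i" "N = Suc (i + e)"
    using assms by (metis Suc_le_D One_nat_def nat_le_iff_add add_Suc)
  consider "j > Suc w" | "j = Suc w" | "j \<le> w" by linarith
  then show ?thesis
  proof cases
    case 3
    then obtain d where d: "w = Suc (i + d)" using ie by (metis nat_le_iff_add add_Suc)
    have e1: "N - j + Suc w = e + i + d + 2" "N - (j - 1) + Suc w = e + i + d + 3"
       "Suc w - j + N = e + i + d + 2" using ie d by auto
    have b1: "real (w choose j) = fact (Suc (i+d)) / (fact (Suc i) * fact d)"
      unfolding ie d by (subst binomial_fact) auto
    have b2: "real (e + i + d + 2 choose Suc w) = fact (e + i + d + 2) / (fact (i + d + 2) * fact e)"
      unfolding ie d by (subst binomial_fact) (auto simp: numeral_2_eq_2)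
    have b3: "real (w choose (j - 1)) = fact (Suc (i+d)) / (fact i * fact (Suc d))"
      unfolding ie d by (subst binomial_fact) (auto simp: Suc_diff_le)
    have b4: "real (e + i + d + 3 choose Suc w) = fact (e + i + d + 3) / (fact (i + d + 2) * fact (Suc e))"
      unfolding ie d by (subst binomial_fact) (auto simp: numeral_2_eq_2 numeral_3_eq_3 Suc_diff_le)
    have b5: "real (Suc N choose j) = fact (i + e + 2) / (fact (Suc i) * fact (Suc e))"
      unfolding ie d by (subst binomial_fact) (auto simp: numeral_2_eq_2 Suc_diff_le)
    have b6: "real (e + i + d + 2 choose N) = fact (e + i + d + 2) / (fact (i + e + 1) * fact (Suc d))"
      unfolding ie d by (subst binomial_fact) (auto simp: numeral_2_eq_2 Suc_diff_le add.commute)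
    have f1: "fact (e + i + d + 3) = (real (e + i + d) + 3) * fact (e + i + d + 2)"
      by (simp add: numeral_3_eq_3 numeral_2_eq_2 algebra_simps)
    have f2: "fact (i + d + 2) = (real (i + d) + 2) * fact (Suc (i + d))"
      by (simp add: numeral_2_eq_2 algebra_simps)
    have f3: "fact (i + e + 2) = (real (i + e) + 2) * fact (i + e + 1)"
      by (simp add: numeral_2_eq_2 algebra_simps)
    have "real ((w choose j) * (e + i + d + 2 choose Suc w) + (w choose (j - 1)) * (e + i + d + 3 choose Suc w))
       = real ((Suc N choose j) * (e + i + d + 2 choose N))"
      unfolding of_nat_add of_nat_mult b1 b2 b3 b4 b5 b6 f1 f2 f3
      unfolding fact_Suc by (simp add: divide_simps) (simp add: algebra_simps)
    then show ?thesis unfolding e1 of_nat_eq_iff using 3 by auto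
  next
    case 2
    hence "N - (j - 1) + Suc w = Suc N" "j - 1 = w" "w choose j = 0" using assms by auto
    thus ?thesis using 2 by (simp del: binomial_Suc_Suc)
  qed auto
qed

text \<open>One factor \<open>1 - s y\<close> of the power cancels against \<open>geo_sy\<close>,
  which leaves \<open>(1 - s y) ^ w / (1 - y) ^ (w + 2)\<close>.\<close>

lemma coeff_gser_power_qser:
  "coeff ((gser ^ Suc w * qser) $ N) j
     = (if j \<le> N then (-1) ^ j * real (w choose j) * real (N - j + Suc w choose Suc w) else 0)"
proof -
  have "gser ^ Suc w * qser = (1 - svar * fps_X) ^ w * geo_y ^ Suc (Suc w) * ((1 - svar * fps_X) * geo_sy)"
    unfolding gser_def power_mult_distrib by (simp only: power_Suc ac_simps)
  also have "\<dots> = (1 - svar * fps_X) ^ w * geo_y ^ Suc (Suc w)" by (simp only: geo_sy_inverse mult_1_right)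
  finally have "(gser ^ Suc w * qser) $ N = 
     (\<Sum>i=0..N. monom ((-1) ^ i * real (w choose i)) i * [:real (N - i + Suc w choose Suc w):])"
    by (simp only: fps_mult_nth one_minus_sy_power_nth geo_y_power_nth of_nat_poly)
  then show ?thesis
    by (auto simp: coeff_sum mult.commute if_distrib[of "\<lambda>x. x * _"] if_distrib[of "\<lambda>x. _ * x"] cong: if_cong)
qed

text \<open>The factor \<open>1 - s\<close> merges adjacent coefficients into one signed product of
  two binomials, the shape of an inclusion-exclusion term in \<open>cnt_formula\<close>. Exponent 0
  is separate because the cancellation in \<open>coeff_gser_power_qser\<close> uses up one factor of
  \<open>gser\<close>.\<close>

lemma coeff_gser_power:
  assumes "j \<le> N"
  shows "coeff ([:1, -1:] * (gser ^ z * qser) $ N) j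
       = (-1) ^ j * real (Suc N choose j) * (if j \<le> z then real (z - j + N choose N) else 0)"
proof -
  have c: "coeff ([:1, -1:] * P) j = coeff P j - (if j = 0 then 0 else coeff P (j - 1))" for P :: "real poly"
    by (cases j) (auto simp: coeff_pCons)
  show ?thesis
  proof (cases z)
    case 0
    then show ?thesis unfolding c using assms by (auto simp: coeff_qser)
  next
    case (Suc w)
    show ?thesis
    proof (cases "j = 0")
      case True
      then show ?thesis unfolding c Suc coeff_gser_power_qser using binomial_symmetric[of "Suc w" "N + Suc w"]
        by (simp add: add.commute del: binomial_Suc_Suc)
    next
      case False
      define x where "x = real (w choose j) * real (N - j + Suc w choose Suc w)"
      define y where "y = real (w choose (j - 1)) * real (N - (j - 1) + Suc w choose Suc w)"
      have "real ((w choose j) * (N - j + Suc w choose Suc w) + (w choose (j - 1)) * (N - (j - 1) + Suc w choose Suc w))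
       = real ((Suc N choose j) * (if j \<le> Suc w then (Suc w - j + N) choose N else 0))"
        using binomial_relation[of j N w] False assms by simp
      hence xy: "x + y = real (Suc N choose j) * (if j \<le> Suc w then real ((Suc w - j + N) choose N) else 0)"
        unfolding x_def y_def of_nat_add of_nat_mult by (simp split: if_splits del: binomial_Suc_Suc)
      have sgn: "(-1) ^ j = - ((-1 :: real) ^ (j - 1))" using False by (cases j) auto
      have "coeff ([:1, -1:] * (gser ^ z * qser) $ N) j = (-1) ^ j * x - (-1) ^ (j - 1) * y"
        unfolding c Suc coeff_gser_power_qser x_def y_def using False assms by (auto simp del: binomial_Suc_Suc)
      also have "\<dots> = (-1) ^ j * (x + y)" unfolding sgn by (simp add: algebra_simps)
      finally show ?thesis unfolding xy Suc by simp
    qed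
  qed
qed

section \<open>Eulerian polynomials and the uniform matroid\<close>

primrec eulerian :: "nat \<Rightarrow> real poly" where
  "eulerian 0 = 1"
| "eulerian (Suc m) = [:1, real m:] * eulerian m + [:0, 1, -1:] * pderiv (eulerian m)"

text \<open>Fixes the normalisation \<open>1, 1, 1 + s, 1 + 4 s + s ^ 2\<close> without a leading
  factor \<open>s\<close>. The recursion mirrors the operator that takes \<open>B\<close> to
  \<open>B + x B'\<close>, which multiplies the coefficient of index \<open>i\<close> by
  \<open>i + 1\<close>.\<close>

lemma fps_of_poly_eulerian:
  "fps_of_poly (eulerian m) = (1 - fps_X) ^ Suc m * Abs_fps (\<lambda>i. real (Suc i) ^ m)"
proof (induction m)
  case 0
  show ?case by (rule fps_ext) (simp add: algebra_simps)
next
  case (Suc m)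
  define B where "B m = Abs_fps (\<lambda>i. real (Suc i) ^ m)" for m
  have B: "B (Suc m) = B m + fps_X * fps_deriv (B m)"
    by (rule fps_ext) (simp add: B_def algebra_simps)
  have D: "fps_deriv ((1 - fps_X) ^ Suc m) = - of_nat (Suc m) * (1 - fps_X :: real fps) ^ m"
    by (simp add: fps_deriv_power fps_of_nat del: of_nat_Suc power_Suc)
  have p: "fps_of_poly [:1, real m:] = 1 + of_nat m * fps_X" "fps_of_poly [:0, 1, -1:] = fps_X * (1 - fps_X :: real fps)"
    by (simp_all add: fps_of_poly_pCons fps_of_nat algebra_simps fps_const_neg[symmetric] del: fps_const_neg)
  have "fps_of_poly (eulerian (Suc m)) = (1 + of_nat m * fps_X) * ((1 - fps_X) ^ Suc m * B m)
     + fps_X * (1 - fps_X) * fps_deriv ((1 - fps_X) ^ Suc m * B m)"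
    unfolding eulerian.simps fps_of_poly_add fps_of_poly_mult fps_of_poly_pderiv p Suc.IH B_def ..
  also have "fps_deriv ((1 - fps_X) ^ Suc m * B m) = (1 - fps_X) ^ Suc m * fps_deriv (B m) - of_nat (Suc m) * (1 - fps_X) ^ m * B m"
    unfolding fps_deriv_mult D by (simp add: algebra_simps)
  also have "(1 + of_nat m * fps_X) * ((1 - fps_X) ^ Suc m * B m) + fps_X * (1 - fps_X) * \<dots> = (1 - fps_X) ^ Suc (Suc m) * (B m + fps_X * fps_deriv (B m))"
    by (simp add: algebra_simps)
  finally show ?case unfolding B[symmetric] by (simp only: B_def)
qed

text \<open>The coefficient of \<open>t ^ m\<close> in \<open>i(U_{k,n}, t)\<close> for \<open>N = n - 1\<close> and \<open>j = k - 1\<close>; with the same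
  indexing, \<open>tcoef\<close> and \<open>tcoef_shift\<close> below belong to \<open>i(T_{k,n}, t)\<close> and \<open>i(T_{k,n}, t - 1)\<close>.\<close>

definition ucoef :: "nat \<Rightarrow> nat \<Rightarrow> nat \<Rightarrow> real" where
  "ucoef N j m = coeff (eulerian m * (lam ^ m * qser) $ N) j / fact m"

text \<open>The Eulerian polynomial is \<open>(1 - s) ^ (m + 1)\<close> times a power series. Of
  these factors, \<open>m\<close> clear the denominator of \<open>lam ^ m\<close>, and the last one
  is kept for \<open>coeff_gser_power\<close>.\<close>

lemma ucoef_eq:
  "ucoef N j m = (\<Sum>i\<le>j. real (Suc i) ^ m / fact m * coeff ([:1, -1:] * ((log_y - log_sy) ^ m * qser) $ N) (j - i))"
proof -
  let ?P = "(lam ^ m * qser) $ N"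
  have c: "fps_const [:1, -1:] = 1 - svar" by (rule fps_ext) (auto simp: one_pCons)
  have "[:1, -1:] ^ Suc m * ?P = [:1, -1:] * (fps_const ([:1, -1:] ^ m) * (lam ^ m * qser)) $ N"
    by (simp only: fps_mult_left_const_nth power_Suc mult.assoc)
  also have "fps_const ([:1, -1:] ^ m) * (lam ^ m * qser) = (log_y - log_sy) ^ m * qser"
    unfolding fps_const_power[symmetric] c one_minus_s_lam[symmetric] power_mult_distrib by (simp only: ac_simps)
  finally have P: "[:1, -1:] ^ Suc m * ?P = [:1, -1:] * ((log_y - log_sy) ^ m * qser) $ N" .
  have X: "fps_of_poly [:1, -1:] = 1 - (fps_X :: real fps)" by (simp add: fps_of_poly_pCons fps_const_neg[symmetric] del: fps_const_neg)
  have "fps_of_poly (eulerian m * ?P) = Abs_fps (\<lambda>i. real (Suc i) ^ m) * fps_of_poly ([:1, -1:] ^ Suc m * ?P)"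
    unfolding fps_of_poly_mult fps_of_poly_power fps_of_poly_eulerian X by (simp only: ac_simps)
  hence "coeff (eulerian m * ?P) j = (Abs_fps (\<lambda>i. real (Suc i) ^ m) * fps_of_poly ([:1, -1:] ^ Suc m * ?P)) $ j"
    by (metis fps_of_poly_nth)
  also have "\<dots> = (\<Sum>i\<le>j. real (Suc i) ^ m * coeff ([:1, -1:] ^ Suc m * ?P) (j - i))"
    by (simp only: fps_mult_nth atMost_atLeast0 fps_of_poly_nth fps_nth_Abs_fps)
  finally show ?thesis unfolding ucoef_def P by (simp add: sum_divide_distrib)
qed

text \<open>For each \<open>i\<close> the sum over \<open>m\<close> is an exponential series and
  collapses to \<open>gser ^ (Suc i * t)\<close>. The result is the classical alternating count of
  lattice points in a dilated hypersimplex.\<close>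

lemma ucoef_sum:
  assumes "j \<le> N"
  shows "(\<Sum>m\<le>N. ucoef N j m * real t ^ m) =
    (\<Sum>i\<le>j. (-1) ^ (j - i) * real (Suc N choose (j - i)) *
        (if j - i \<le> Suc i * t then real (Suc i * t - (j - i) + N choose N) else 0))"
proof -
  have z: "(\<Sum>m\<le>N. smult (real z ^ m / fact m) (((log_y - log_sy) ^ m * qser) $ N)) = (gser ^ z * qser) $ N" for z
  proof (rule exp_series_mult_nth)
    show "(log_y - log_sy) $ 0 = 0" by (simp add: log_y_def log_sy_div_def)
    show "gser $ 0 = 1" by (simp add: gser_def geo_y_def)
  qed (simp_all only: deriv_gser order_refl)
  have "(\<Sum>m\<le>N. ucoef N j m * real t ^ m) = (\<Sum>i\<le>j. \<Sum>m\<le>N. 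
      real (Suc i * t) ^ m / fact m * coeff ([:1, -1:] * ((log_y - log_sy) ^ m * qser) $ N) (j - i))"
  proof -
    have "(\<Sum>m\<le>N. (\<Sum>i\<le>j. real (Suc i) ^ m / fact m * Q m i) * real t ^ m)
      = (\<Sum>i\<le>j. \<Sum>m\<le>N. real (Suc i * t) ^ m / fact m * Q m i)" for Q :: "nat \<Rightarrow> nat \<Rightarrow> real"
      unfolding sum_distrib_right
      by (subst sum.swap, intro sum.cong refl, simp only: of_nat_mult power_mult_distrib)
        (simp del: of_nat_Suc)
    thus ?thesis unfolding ucoef_eq .
  qed
  also have "\<dots> = (\<Sum>i\<le>j. coeff ([:1, -1:] * (gser ^ (Suc i * t) * qser) $ N) (j - i))"
    unfolding z[symmetric] sum_distrib_left coeff_sum mult_smult_right coeff_smult ..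
  also have "\<dots> = (\<Sum>i\<le>j. (-1) ^ (j - i) * real (Suc N choose (j - i)) *
        (if j - i \<le> Suc i * t then real (Suc i * t - (j - i) + N choose N) else 0))"
    using assms by (intro sum.cong refl coeff_gser_power) auto
  finally show ?thesis .
qed

section \<open>Coefficientwise comparison\<close>

definition fle :: "real poly fps \<Rightarrow> real poly fps \<Rightarrow> bool" (infix "\<preceq>" 50) where
  "f \<preceq> g \<longleftrightarrow> (\<forall>n j. coeff (f $ n) j \<le> coeff (g $ n) j)"

lemma fle_refl [simp]: "f \<preceq> f" by (simp add: fle_def)

lemma fle_trans [trans]: "f \<preceq> g \<Longrightarrow> g \<preceq> h \<Longrightarrow> f \<preceq> h"
  unfolding fle_def by (meson order_trans)

lemma fle_add: "f \<preceq> f' \<Longrightarrow> g \<preceq> g' \<Longrightarrow> f + g \<preceq> f' + g'"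
  by (auto simp: fle_def intro: add_mono)

lemma fle_iff_diff: "f \<preceq> g \<longleftrightarrow> 0 \<preceq> g - f"
  by (auto simp: fle_def)

lemma nonneg_add: "0 \<preceq> f \<Longrightarrow> 0 \<preceq> g \<Longrightarrow> 0 \<preceq> f + g"
  using fle_add[of 0 f 0 g] by simp

lemma nonneg_mult: "0 \<preceq> f \<Longrightarrow> 0 \<preceq> g \<Longrightarrow> 0 \<preceq> f * g"
  by (auto simp: fle_def fps_mult_nth coeff_sum coeff_mult intro!: sum_nonneg)

lemma nonneg_one: "0 \<preceq> 1"
  by (auto simp: fle_def)

lemma nonneg_power: "0 \<preceq> f \<Longrightarrow> 0 \<preceq> f ^ n"
  by (induction n) (auto intro: nonneg_mult nonneg_one)

lemma nonneg_sum: "(\<And>i. i \<in> I \<Longrightarrow> 0 \<preceq> f i) \<Longrightarrow> 0 \<preceq> sum f I"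
  by (induction I rule: infinite_finite_induct) (auto intro: nonneg_add)

lemma nonneg_of_nat: "0 \<preceq> of_nat n"
  by (induction n) (auto intro: nonneg_add nonneg_one)

lemma fle_mult:
  assumes "f \<preceq> f'" "g \<preceq> g'" "0 \<preceq> f" "0 \<preceq> g"
  shows "f * g \<preceq> f' * g'"
proof -
  have "0 \<preceq> g'" using assms fle_trans by blast
  hence "0 \<preceq> (f' - f) * g' + f * (g' - g)"
    using assms by (intro nonneg_add nonneg_mult) (simp_all add: fle_iff_diff[symmetric])
  thus ?thesis by (subst fle_iff_diff) (simp add: algebra_simps)
qed

lemma fle_power: "f \<preceq> g \<Longrightarrow> 0 \<preceq> f \<Longrightarrow> f ^ n \<preceq> g ^ n"
  by (induction n) (auto intro: fle_mult nonneg_power)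

lemma fle_sum: "(\<And>i. i \<in> I \<Longrightarrow> f i \<preceq> g i) \<Longrightarrow> sum f I \<preceq> sum g I"
  by (induction I rule: infinite_finite_induct) (auto intro: fle_add)

lemma coeff_fps_X: "coeff ((fps_X :: real poly fps) $ n) j = (if n = 1 \<and> j = 0 then 1 else 0)"
  by (auto simp: fps_X_def)

lemma nonneg_series:
  "0 \<preceq> svar" "0 \<preceq> fps_X" "0 \<preceq> lam" "0 \<preceq> log_y" "0 \<preceq> log_sy_div" "0 \<preceq> qser" "0 \<preceq> rser"
  "0 \<preceq> log_sy" "0 \<preceq> lser"
proof -
  show s: "0 \<preceq> svar" by (auto simp: fle_def fps_const_def coeff_pCons split: nat.split)
  show d: "0 \<preceq> log_sy_div" unfolding fle_def coeff_log_sy_div by auto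
  show y: "0 \<preceq> log_y" unfolding fle_def coeff_log_y by auto
  show sy: "0 \<preceq> log_sy" by (intro nonneg_mult s d)
  show "0 \<preceq> lser" by (intro nonneg_add y sy)
qed (auto simp: fle_def coeff_fps_X coeff_lam coeff_rser coeff_qser)

text \<open>Apart from the last bound: \<open>lam\<close> has \<open>1 / n\<close> at every power of
  \<open>s\<close> below \<open>n\<close>, whereas \<open>log_y\<close> and
  \<open>log_sy_div\<close> occupy only the lowest and the highest of them. These ends coincide for
  \<open>n = 1\<close>, hence the subtraction of \<open>fps_X\<close>.\<close>

lemma series_bounds:
  "log_y \<preceq> lam" "log_sy \<preceq> svar * lam" "log_sy_div \<preceq> lam"
  "log_y + log_sy_div - fps_X \<preceq> lam"
  "log_sy_div - fps_X \<preceq> lam - log_y"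
  "svar * (log_y - fps_X) \<preceq> svar * lam - log_sy"
  "0 \<preceq> log_sy_div - fps_X" "0 \<preceq> log_y - fps_X"
  "lam \<preceq> lam * qser"
proof -
  show "log_y \<preceq> lam" unfolding fle_def coeff_log_y coeff_lam by auto
  show "log_sy_div \<preceq> lam" unfolding fle_def coeff_log_sy_div coeff_lam by auto
  show "log_sy \<preceq> svar * lam" unfolding fle_def coeff_log_sy coeff_svar_mult coeff_lam by (auto simp: coeff_log_sy_div)
  show "log_y + log_sy_div - fps_X \<preceq> lam"
    unfolding fle_def fps_add_nth fps_sub_nth coeff_add coeff_diff coeff_log_y coeff_log_sy_div coeff_lam coeff_fps_X by auto
  show "log_sy_div - fps_X \<preceq> lam - log_y"
    unfolding fle_def fps_add_nth fps_sub_nth coeff_add coeff_diff coeff_log_y coeff_log_sy_div coeff_lam coeff_fps_X by auto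
  show "0 \<preceq> log_sy_div - fps_X" "0 \<preceq> log_y - fps_X"
    unfolding fle_def fps_add_nth fps_sub_nth coeff_add coeff_diff coeff_log_y coeff_log_sy_div coeff_fps_X by auto
  show "svar * (log_y - fps_X) \<preceq> svar * lam - log_sy"
    unfolding right_diff_distrib fle_def fps_sub_nth coeff_diff coeff_svar_mult coeff_log_sy_div coeff_log_y coeff_lam coeff_fps_X
    by auto
  have "1 \<preceq> qser" unfolding fle_def coeff_qser by auto
  hence "lam * 1 \<preceq> lam * qser" by (intro fle_mult fle_refl nonneg_series nonneg_one)
  thus "lam \<preceq> lam * qser" by simp
qed

text \<open>From \<open>1 / qser = 1 - y (1 + s - s y)\<close> follows
  \<open>qser = 1 + y (1 + s - s y) qser\<close>; multiply by \<open>rser\<close> and apply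
  \<open>rser_functional\<close>.\<close>

lemma qser_rser: "qser * rser = rser + fps_X * (qser * lser)"
proof -
  have "(1 - fps_X) * geo_y * ((1 - svar * fps_X) * geo_sy) = 1"
    by (simp add: geo_y_inverse geo_sy_inverse)
  hence "qser * (1 - fps_X) * (1 - svar * fps_X) = 1" by (simp only: ac_simps)
  hence "rser = qser * (1 - fps_X) * (1 - svar * fps_X) * rser" by simp
  hence "rser + fps_X * (qser * lser) = qser * (1 - fps_X) * (1 - svar * fps_X) * rser + fps_X * (qser * ((1 + svar - svar * fps_X) * rser))"
    unfolding rser_functional by simp
  also have "\<dots> = qser * rser * ((1 - fps_X) * (1 - svar * fps_X) + fps_X * (1 + svar - svar * fps_X))"
    by (simp only: algebra_simps)
  also have "\<dots> = qser * rser" by (simp add: algebra_simps)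
  finally show ?thesis by simp
qed

section \<open>Harmonic sums and the linear coefficient\<close>

abbreviation hsum :: "nat \<Rightarrow> real" where "hsum n \<equiv> (\<Sum>r=1..n. 1 / real r)"

lemma hsum_diff_ge:
  assumes "i \<le> n"
  shows "hsum n - hsum i \<ge> real (n - i) / real n"
proof -
  have "hsum n - hsum i = (\<Sum>r=Suc i..n. 1 / real r)"
    using assms sum.ub_add_nat[of 1 i "\<lambda>r. 1 / real r" "n - i"] by simp
  also have "\<dots> \<ge> (\<Sum>r=Suc i..n. 1 / real n)"
    by (rule sum_mono) (auto simp: frac_le)
  finally show ?thesis using assms by simp
qed

lemma coeff_qser_lser:
  assumes "j \<le> M"
  shows "coeff ((qser * lser) $ M) j = hsum j + hsum (M - j)"
proof -
  have "coeff ((qser * lser) $ M) j = coeff ((qser * log_y) $ M) j + coeff ((svar * (log_sy_div * qser)) $ M) j"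
    by (simp add: algebra_simps)
  also have "coeff ((qser * log_y) $ M) j = hsum (M - j)"
  proof -
    have "coeff ((qser * log_y) $ M) j = (\<Sum>i=0..M. coeff (qser $ (M - i)) j / real i)"
      by (subst mult.commute) (simp add: fps_mult_nth coeff_sum log_y_def)
    also have "\<dots> = (\<Sum>i=1..M-j. 1 / real i)"
      by (rule sum.mono_neutral_cong_right) (use assms in \<open>auto simp: coeff_qser\<close>)
    finally show ?thesis .
  qed
  also have "coeff ((svar * (log_sy_div * qser)) $ M) j = hsum j"
  proof (cases j)
    case (Suc i)
    have "coeff ((svar * (log_sy_div * qser)) $ M) j = coeff ((log_sy_div * qser) $ M) i"
      unfolding coeff_svar_mult Suc by simp
    also have "\<dots> = (\<Sum>r=0..M. coeff (monom (1 / real r) (r - 1) * qser $ (M - r)) i)"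
      unfolding fps_mult_nth[of log_sy_div] coeff_sum by (simp add: log_sy_div_def)
    also have "\<dots> = (\<Sum>r=1..j. 1 / real r)"
    proof (rule sum.mono_neutral_cong_right)
    qed (use assms Suc in \<open>auto simp: coeff_monom_mult coeff_qser\<close>)
    finally show ?thesis .
  qed (use coeff_svar_mult in auto)
  finally show ?thesis by simp
qed

text \<open>Up to the factor \<open>1 / r\<close> this counts the ways to write \<open>j\<close> as
  a number below \<open>r\<close> plus a number up to \<open>M\<close>. Two ways exist once both
  ranges have two elements and \<open>j\<close> is not extreme.\<close>

lemma coeff_lam_qser_term:
  assumes "r \<ge> 1"
  shows "j < r + M \<Longrightarrow> coeff (lam $ r * qser $ M) j \<ge> 1 / real r"
    and "r \<ge> 2 \<Longrightarrow> M \<ge> 1 \<Longrightarrow> 1 \<le> j \<Longrightarrow> j + 2 \<le> r + M \<Longrightarrow> coeff (lam $ r * qser $ M) j \<ge> 2 / real r"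
proof -
  have c: "coeff (lam $ r * qser $ M) j = (\<Sum>i\<le>j. if i < r \<and> j - i \<le> M then 1 / real r else 0)"
    unfolding coeff_mult coeff_lam coeff_qser by (rule sum.cong) auto
  have sub: "coeff (lam $ r * qser $ M) j \<ge> (\<Sum>i\<in>I. 1 / real r)"
    if I: "I \<subseteq> {..j}" "\<And>i. i \<in> I \<Longrightarrow> i < r \<and> j - i \<le> M" for I
  proof -
    have "(\<Sum>i\<in>I. 1 / real r) = (\<Sum>i\<in>I. if i < r \<and> j - i \<le> M then 1 / real r else 0)"
      using I by (intro sum.cong) auto
    also have "\<dots> \<le> (\<Sum>i\<le>j. if i < r \<and> j - i \<le> M then 1 / real r else 0)"
      using I by (intro sum_mono2) auto
    finally show ?thesis unfolding c .
  qed
  show "coeff (lam $ r * qser $ M) j \<ge> 1 / real r" if "j < r + M"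
    using sub[of "{min j (r - 1)}"] that assms by (cases "j \<le> r - 1") (auto simp: min_def)
  show "coeff (lam $ r * qser $ M) j \<ge> 2 / real r" if "r \<ge> 2" "M \<ge> 1" "1 \<le> j" "j + 2 \<le> r + M"
  proof (cases "j \<le> r - 1")
    case True
    have "(\<Sum>i\<in>{j, j - 1}. 1 / real r) \<le> coeff (lam $ r * qser $ M) j"
      using that True by (intro sub) auto
    thus ?thesis using that by (simp add: card_insert_if split: if_splits)
  next
    case False
    have "(\<Sum>i\<in>{r - 1, r - 2}. 1 / real r) \<le> coeff (lam $ r * qser $ M) j"
      using that False by (intro sub) auto
    thus ?thesis using that by (simp add: card_insert_if split: if_splits)
  qed
qed

lemma binomial_ge_2: "0 < k \<Longrightarrow> k < n \<Longrightarrow> (n choose k) \<ge> 2"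
proof -
  assume k: "0 < k" "k < n"
  then obtain n' k' where e: "n = Suc n'" "k = Suc k'" by (metis gr0_implies_Suc not_less0 gr0I)
  have "(n' choose k') \<ge> 1" "(n' choose Suc k') \<ge> 1" using k e by (simp_all add: Suc_le_eq zero_less_binomial)
  thus ?thesis unfolding e binomial_Suc_Suc by linarith
qed

lemma coeff_mult_high:
  assumes "\<And>n j. n < j \<Longrightarrow> coeff (f $ n) j = 0" "\<And>n j. n < j \<Longrightarrow> coeff (g $ n) j = 0" "n < j"
  shows "coeff ((f * g :: real poly fps) $ n) j = 0"
proof -
  have "coeff (f $ i) a * coeff (g $ (n - i)) (j - a) = 0" if "i \<le> n" "a \<le> j" for i a
    using assms that by (cases "i < a") auto
  thus ?thesis unfolding fps_mult_nth coeff_sum coeff_mult by (intro sum.neutral ballI) auto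
qed

text \<open>By \<open>qser_rser\<close> the left coefficient is twice an entry of
  \<open>rser\<close> plus two harmonic sums. At interior powers of \<open>s\<close> the product
  \<open>lam * qser\<close> dominates it alone; the other series contribute only at the ends
  \<open>j = 0\<close> and \<open>j = N - 1\<close>.\<close>

lemma rser_bound: "(1 + qser) * rser \<preceq> lam * qser + log_y + log_sy_div - fps_X"
  unfolding fle_def
proof (intro allI)
  fix N j
  let ?W = "coeff ((lam * qser) $ N) j"
  have W: "?W = (\<Sum>r=0..N. coeff (lam $ r * qser $ (N - r)) j)"
    by (simp only: fps_mult_nth coeff_sum)
  have W1: "(\<Sum>r=0..N. coeff (lam $ r * qser $ (N - r)) j) = (\<Sum>r=1..N. coeff (lam $ r * qser $ (N - r)) j)"
    by (rule sum.mono_neutral_right) (auto simp: lam_def not_less_eq_eq)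
  have L: "coeff (((1 + qser) * rser) $ N) j = 2 * coeff (rser $ N) j + (if N = 0 then 0 else coeff ((qser * lser) $ (N - 1)) j)"
  proof -
    have "(1 + qser) * rser = rser + (rser + fps_X * (qser * lser))"
      unfolding qser_rser[symmetric] by (simp add: algebra_simps)
    thus ?thesis by (simp only: fps_add_nth coeff_add fps_X_mult_nth) auto
  qed
  have Wnn: "?W \<ge> 0"
    using nonneg_mult[OF nonneg_series(3,6)] unfolding fle_def by simp
  show "coeff (((1 + qser) * rser) $ N) j \<le> coeff ((lam * qser + log_y + log_sy_div - fps_X) $ N) j"
  proof (cases "j < N")
    case False
    have "coeff ((qser * lser) $ (N - 1)) j = 0" if "N \<noteq> 0"
      using False that by (intro coeff_mult_high[of qser lser])
        (simp_all only: fps_add_nth coeff_add coeff_qser coeff_log_y coeff_log_sy, auto)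
    thus ?thesis unfolding L fps_add_nth fps_sub_nth coeff_add coeff_diff coeff_rser coeff_log_y coeff_log_sy_div coeff_fps_X
      using False Wnn by auto
  next
    case True
    have QL: "coeff ((qser * lser) $ (N - 1)) j = hsum j + hsum (N - 1 - j)"
      using True by (intro coeff_qser_lser) auto
    have W2: "?W \<ge> hsum N"
      unfolding W W1 using True by (intro sum_mono coeff_lam_qser_term(1)) auto
    consider "N = 1" | "N \<ge> 2" "j = 0" | "N \<ge> 2" "j = N - 1" | "1 \<le> j" "j + 2 \<le> N" using True by linarith
    then show ?thesis
    proof cases
      case 1
      thus ?thesis unfolding L QL fps_add_nth fps_sub_nth coeff_add coeff_diff coeff_rser coeff_log_y coeff_log_sy_div coeff_fps_X
        using True W2 by auto
    next
      case 2
      have "hsum N = hsum (N - 1) + 1 / real N" using 2 by (cases N) auto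
      thus ?thesis unfolding L QL fps_add_nth fps_sub_nth coeff_add coeff_diff coeff_rser coeff_log_y coeff_log_sy_div coeff_fps_X
        using 2 W2 by auto
    next
      case 3
      have "hsum N = hsum (N - 1) + 1 / real N" using 3 by (cases N) auto
      thus ?thesis unfolding L QL fps_add_nth fps_sub_nth coeff_add coeff_diff coeff_rser coeff_log_y coeff_log_sy_div coeff_fps_X
        using 3 W2 by auto
    next
      case 4
      \<comment> \<open>In the interior the terms with \<open>2 \<le> r < N\<close> count twice,
        which yields \<open>hsum N + hsum (N - 1) - 1\<close>.\<close>
      have "(\<Sum>r=1..N. 1 / real r + (if 2 \<le> r \<and> r < N then 1 / real r else 0)) \<le> ?W"
        unfolding W W1
      proof (rule sum_mono)
        fix r assume r: "r \<in> {1..N}"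
        show "1 / real r + (if 2 \<le> r \<and> r < N then 1 / real r else 0) \<le> coeff (lam $ r * qser $ (N - r)) j"
          using coeff_lam_qser_term[where r = r and j = j and M = "N - r"] r 4 by (auto simp: add_divide_distrib[symmetric])
      qed
      also have "(\<Sum>r=1..N. 1 / real r + (if 2 \<le> r \<and> r < N then 1 / real r else 0))
          = hsum N + (\<Sum>r=2..N-1. 1 / real r)"
        unfolding sum.distrib by (intro arg_cong2[of _ _ _ _ plus] refl sum.mono_neutral_cong_right) auto
      also have "(\<Sum>r=2..N-1. 1 / real r) = hsum (N - 1) - 1"
        using 4 sum.atLeast_Suc_atMost[of 1 "N - 1" "\<lambda>r. 1 / real r"] by (simp add: numeral_2_eq_2)
      also have "hsum N = hsum (N - 1) + 1 / real N" using 4 by (cases N) auto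
      finally have W3: "2 * hsum (N - 1) + 1 / real N - 1 \<le> ?W" by simp
      \<comment> \<open>The harmonic sums fall short of \<open>2 * hsum (N - 1)\<close> by at least
        \<open>(N - 1 - j) / (N - 1) + j / (N - 1) = 1\<close>, the 1 subtracted in
        \<open>W3\<close>. The \<open>1 / N\<close> in \<open>W3\<close> covers the two entries of
        \<open>rser\<close>, as the binomial is at least 2.\<close>
      have "hsum (N - 1) - hsum j \<ge> real (N - 1 - j) / real (N - 1)"
        and "hsum (N - 1) - hsum (N - 1 - j) \<ge> real (N - 1 - (N - 1 - j)) / real (N - 1)"
        using 4 by (intro hsum_diff_ge; simp)+
      moreover have "real (N - 1 - j) / real (N - 1) + real (N - 1 - (N - 1 - j)) / real (N - 1) = 1"
        using 4 by (simp add: add_divide_distrib[symmetric] of_nat_diff)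
      moreover have "2 / (real N * real (N - 1 choose j)) \<le> 1 / real N"
      proof -
        have "(N - 1 choose j) \<ge> 2" using 4 by (intro binomial_ge_2) auto
        thus ?thesis using 4 by (simp add: field_simps)
      qed
      ultimately show ?thesis unfolding L QL fps_add_nth fps_sub_nth coeff_add coeff_diff coeff_rser coeff_log_y coeff_log_sy_div coeff_fps_X
        using 4 W3 by auto
    qed
  qed
qed

section \<open>Powers of the logarithm\<close>

lemma power_add_split_ends:
  fixes x y :: "'a :: comm_semiring_1"
  assumes "p \<ge> 1"
  shows "(x + y) ^ p = x ^ p + y ^ p + (\<Sum>i\<in>{1..<p}. of_nat (p choose i) * x ^ i * y ^ (p - i))"
proof -
  have "(x + y) ^ p = (\<Sum>i\<in>{0..p}. of_nat (p choose i) * x ^ i * y ^ (p - i))"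
    by (simp add: binomial_ring atMost_atLeast0)
  also have "{0..p} = insert 0 (insert p {1..<p})" using assms by auto
  finally show ?thesis using assms by (simp add: add_ac)
qed

text \<open>The difference of the two sides is \<open>g * (g ^ p - f ^ p)\<close>.\<close>

lemma power_diff_ge:
  assumes "f \<preceq> g" "0 \<preceq> f"
  shows "f ^ p * (g - f) \<preceq> g ^ Suc p - f ^ Suc p"
proof -
  have "0 \<preceq> g" using assms fle_trans by blast
  moreover have "0 \<preceq> g ^ p - f ^ p" using fle_power[OF assms] fle_iff_diff by blast
  ultimately have "0 \<preceq> g * (g ^ p - f ^ p)" by (rule nonneg_mult)
  thus ?thesis by (subst fle_iff_diff) (simp add: algebra_simps)
qed

text \<open>Binomial expansion of both sides: the mixed terms of \<open>lser ^ p\<close> are dominated by those of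
  \<open>((1 + s) lam) ^ p\<close>, and the two pure powers of \<open>log_y\<close> and \<open>log_sy\<close> by the differences
  \<open>lam ^ p - log_y ^ p\<close> and \<open>(s lam) ^ p - log_sy ^ p\<close>. The two remaining terms on the right only have
  extreme powers of \<open>s\<close>, which correspond to \<open>k = 1\<close> and \<open>k = n - 1\<close>.\<close>

lemma rser_lser_power_bound:
  assumes "p \<ge> 1"
  shows "(1 + qser) * rser * lser ^ p \<preceq>
    (2 * ((1 + svar) * lam) ^ p - lam ^ p - (svar * lam) ^ p) * (lam * qser)
      + log_y ^ Suc p + log_sy ^ p * log_sy_div"
proof -
  define W where "W = lam * qser"
  define A where "A = log_y"
  define B where "B = log_sy"
  define B' where "B' = log_sy_div"
  define C where "C = lam"
  define D where "D = svar * lam"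
  define mid where "mid x y = (\<Sum>i\<in>{1..<p}. of_nat (p choose i) * x ^ i * y ^ (p - i))" for x y :: "real poly fps"
  note defs = W_def A_def B_def B'_def C_def D_def
  obtain r where p: "p = Suc r" using assms by (cases p) auto
  have nn: "0 \<preceq> W" "0 \<preceq> A" "0 \<preceq> B" "0 \<preceq> B'" "0 \<preceq> C" "0 \<preceq> D"
    unfolding defs by (intro nonneg_series nonneg_mult)+
  have sb: "A \<preceq> C" "B \<preceq> D" "B' \<preceq> C" "A + B' - fps_X \<preceq> C" "B' - fps_X \<preceq> C - A"
    "svar * (A - fps_X) \<preceq> D - B" "0 \<preceq> B' - fps_X" "0 \<preceq> A - fps_X" "C \<preceq> W"
    unfolding defs by (fact series_bounds)+
  have B: "B = svar * B'" unfolding defs ..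
  have AW: "A \<preceq> W" and BW: "B' \<preceq> W" using sb fle_trans by blast+
  have mid_nn: "0 \<preceq> mid A B"
    unfolding mid_def by (intro nonneg_sum nonneg_mult nonneg_power nonneg_of_nat nn)
  have mid_le: "mid A B \<preceq> mid C D"
    unfolding mid_def by (intro fle_sum fle_mult fle_power sb nn nonneg_mult nonneg_power nonneg_of_nat fle_refl)
  have X: "0 \<preceq> A + B' - fps_X"
    using nonneg_add[OF nn(2) sb(7)] by (simp add: algebra_simps)
  have "(1 + qser) * rser * (A + B) ^ p \<preceq> (W + A + B' - fps_X) * (A + B) ^ p"
    unfolding defs
    by (intro fle_mult rser_bound nonneg_power nonneg_series nonneg_mult nonneg_add nonneg_one fle_refl)
  \<comment> \<open>Beside \<open>A ^ p\<close> the part \<open>A\<close> of the bracket becomes the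
    end term \<open>A ^ Suc p\<close>, and the surplus \<open>B' - fps_X\<close> is set aside, to be
    bounded by \<open>C - A\<close>. Beside \<open>B ^ p\<close> the roles are played by
    \<open>B'\<close> and by \<open>svar * (A - fps_X)\<close>, bounded by
    \<open>D - B\<close>.\<close>
  also have "\<dots> = mid A B * W + (A ^ p + B ^ p) * W + mid A B * (A + B' - fps_X)
       + A ^ r * ((B' - fps_X) * A) + B ^ r * ((svar * (A - fps_X)) * B') + (A ^ Suc p + B ^ p * B')"
  proof -
    have ring: "(w + x + y - z) * (a * x + b * (s * y) + M) = M * w + (a * x + b * (s * y)) * w
        + M * (x + y - z) + a * ((y - z) * x) + b * ((s * (x - z)) * y) + (a * x * x + b * (s * y) * y)"
      for w x y z a b s M :: "real poly fps" by (simp add: algebra_simps)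
    have "A ^ p = A ^ r * A" "B ^ p = B ^ r * (svar * B')" "A ^ Suc p = A ^ r * A * A"
      unfolding p power_Suc2 B[symmetric] by (rule refl)+
    thus ?thesis
      unfolding power_add_split_ends[OF assms] mid_def[symmetric] by (simp only: ring)
  qed
  also have "\<dots> \<preceq> mid C D * W + (A ^ p + B ^ p) * W + mid C D * W
       + A ^ r * ((C - A) * W) + B ^ r * ((D - B) * W) + (A ^ Suc p + B ^ p * B')"
    by (intro fle_add fle_mult fle_refl mid_le mid_nn nn nonneg_mult nonneg_power nonneg_series sb X AW BW
        fle_trans[OF sb(4) sb(9)])
  \<comment> \<open>With \<open>power_diff_ge\<close> the pure powers of \<open>A\<close> and
    \<open>B\<close> next to \<open>W\<close> cancel and leave those of \<open>C\<close> and
    \<open>D\<close>.\<close>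
  also have "\<dots> \<preceq> mid C D * W + (A ^ p + B ^ p) * W + mid C D * W
       + (C ^ p - A ^ p) * W + (D ^ p - B ^ p) * W + (A ^ Suc p + B ^ p * B')"
  proof -
    have "A ^ r * (C - A) * W \<preceq> (C ^ p - A ^ p) * W" "B ^ r * (D - B) * W \<preceq> (D ^ p - B ^ p) * W"
      unfolding p using sb(1,2)
      by (intro fle_mult power_diff_ge sb nn fle_refl nonneg_mult nonneg_power; simp add: fle_iff_diff[symmetric])+
    thus ?thesis by (intro fle_add fle_refl) (simp_all only: mult.assoc)
  qed
  also have "\<dots> = (2 * (C + D) ^ p - C ^ p - D ^ p) * W + (A ^ Suc p + B ^ p * B')"
    unfolding power_add_split_ends[OF assms] mid_def[symmetric] by (simp add: algebra_simps)
  also have "C + D = (1 + svar) * lam" unfolding defs by (simp add: algebra_simps)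
  finally show ?thesis unfolding defs by (simp only: add.assoc)
qed

section \<open>Lower bounds for Eulerian numbers\<close>

lemma coeff_eulerian_Suc:
  "coeff (eulerian (Suc m)) i = (real i + 1) * coeff (eulerian m) i
     + (if i = 0 then 0 else (real m + 1 - real i) * coeff (eulerian m) (i - 1))"
  by (cases i) (auto simp: coeff_pCons coeff_pderiv algebra_simps split: nat.split)

lemma coeff_eulerian_0: "p < i \<Longrightarrow> coeff (eulerian (Suc p)) i = 0"
proof (induction p arbitrary: i)
  case 0
  then show ?case by (subst coeff_eulerian_Suc) (auto simp: coeff_pCons split: nat.split)
next
  case (Suc p)
  then show ?case by (subst coeff_eulerian_Suc) auto
qed

text \<open>For \<open>i \<le> Suc p\<close> both weights of the Eulerian recurrence are at least 1,
  so its triangle dominates that of Pascal.\<close>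

lemma coeff_eulerian_ge: "real (p choose i) \<le> coeff (eulerian (Suc p)) i"
proof (induction p arbitrary: i)
  case 0
  then show ?case by (subst coeff_eulerian_Suc, cases i) (auto simp: coeff_pCons split: nat.split)
next
  case (Suc p)
  have nn: "0 \<le> coeff (eulerian (Suc p)) i" for i using Suc.IH[of i] by (meson of_nat_0_le_iff order_trans)
  show ?case
  proof (cases "i \<le> Suc p")
    case True
    have 1: "(real i + 1) * coeff (eulerian (Suc p)) i \<ge> 1 * real (p choose i)"
      using Suc.IH[of i] by (intro mult_mono) auto
    have 2: "(real (Suc p) + 1 - real i) * coeff (eulerian (Suc p)) (i - 1) \<ge> 1 * real (p choose (i - 1))"
      using Suc.IH[of "i - 1"] True by (intro mult_mono) auto
    show ?thesis
      by (subst coeff_eulerian_Suc, cases i) (use 1 2 nn[of 0] in auto)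
  next
    case False
    then show ?thesis by (simp add: coeff_eulerian_0 del: eulerian.simps)
  qed
qed

text \<open>For \<open>1 \<le> i < p\<close> both weights are at least 2, which doubles the previous
  bound; at the two ends the subtracted 1 reduces the claim to that bound.\<close>

lemma coeff_eulerian_ge_twice:
  assumes "p \<ge> 1"
  shows "coeff (eulerian (Suc p)) i \<ge> 2 * real (p choose i) - (if i = 0 then 1 else 0) - (if i = p then 1 else 0)"
proof (cases "1 \<le> i \<and> i < p")
  case True
  obtain r where p: "p = Suc r" using assms by (cases p) auto
  have 1: "(real i + 1) * coeff (eulerian p) i \<ge> 2 * real (r choose i)"
    unfolding p using True coeff_eulerian_ge[of r i] by (intro mult_mono) auto
  have 2: "(real p + 1 - real i) * coeff (eulerian p) (i - 1) \<ge> 2 * real (r choose (i - 1))"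
    unfolding p using True p coeff_eulerian_ge[of r "i - 1"] by (intro mult_mono) auto
  show ?thesis
    by (subst coeff_eulerian_Suc, cases i) (use 1 2 p True in auto)
next
  case False
  hence "i = 0 \<or> i = p \<or> i > p" by auto
  then show ?thesis using coeff_eulerian_ge[of p i] assms by (auto simp: coeff_eulerian_0 simp del: eulerian.simps)
qed

lemma eulerian_bound:
  assumes "p \<ge> 1"
  shows "2 * (1 + svar) ^ p - 1 - svar ^ p \<preceq> fps_const (eulerian (Suc p))"
proof -
  have e: "2 * (1 + svar) ^ p - 1 - svar ^ p = fps_const (2 * [:1, 1:] ^ p - 1 - [:0, 1:] ^ p)"
  proof -
    have "1 + svar = fps_const [:1, 1:]" by (rule fps_ext) (simp add: one_pCons)
    hence 1: "(1 + svar) ^ p = fps_const ([:1, 1:] ^ p)" by (simp only: fps_const_power)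
    have 2: "(2 :: real poly fps) = fps_const 2" "(1 :: real poly fps) = fps_const 1"
      by (simp_all only: numeral_fps_const fps_const_1_eq_1)
    show ?thesis unfolding 1 unfolding 2 by (simp only: fps_const_power fps_const_mult fps_const_sub)
  qed
  have c: "coeff ([:1, 1:] ^ p) i = real (p choose i)" for i
    by (cases "i \<le> p") (auto simp: coeff_linear_poly_power coeff_eq_0 degree_linear_power binomial_eq_0)
  have c2: "coeff ([:0, 1:] ^ p :: real poly) i = (if i = p then 1 else 0)" for i
    by (simp add: monom_altdef[symmetric, of 1, simplified])
  have n: "coeff (2 * P) i = 2 * coeff P i" for P :: "real poly" and i
    by (metis coeff_add mult_2)
  show ?thesis
    unfolding e fle_def
  proof (intro allI)
    fix k j
    show "coeff (fps_const (2 * [:1, 1:] ^ p - 1 - [:0, 1:] ^ p) $ k) j \<le> coeff (fps_const (eulerian (Suc p)) $ k) j"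
    proof (cases "k = 0")
      case True
      have "coeff (2 * [:1, 1:] ^ p - 1 - [:0, 1:] ^ p) j \<le> coeff (eulerian (Suc p)) j"
        using coeff_eulerian_ge_twice[OF assms, of j] unfolding coeff_diff n c c2 coeff_1 by (simp del: eulerian.simps split: if_splits)
      thus ?thesis unfolding True by (simp only: fps_nth_fps_const if_True simp_thms)
    qed simp
  qed
qed

section \<open>Comparison and positivity of the coefficients\<close>

definition tcoef :: "nat \<Rightarrow> nat \<Rightarrow> nat \<Rightarrow> real" where
  "tcoef N j m = (if m = 0 then 1 else coeff ((qser * (rser * lser ^ (m - 1))) $ N) j / fact m)"

definition tcoef_shift :: "nat \<Rightarrow> nat \<Rightarrow> nat \<Rightarrow> real" where
  "tcoef_shift N j m = (if m = 0 then 0 else coeff ((rser * lser ^ (m - 1)) $ N) j / fact m)"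

lemma tcoef_shift_nonneg: "0 \<le> tcoef_shift N j m"
  using nonneg_mult[OF nonneg_series(7) nonneg_power[OF nonneg_series(9)]]
  by (auto simp: tcoef_shift_def fle_def)

text \<open>Both series live on diagonals, \<open>log_sy\<close> on \<open>j = n\<close> and
  \<open>log_sy_div\<close> on \<open>Suc j = n\<close>, and products add the indices.\<close>

lemma coeff_log_sy_power_mult:
  "coeff ((log_sy ^ p * log_sy_div) $ N) j \<noteq> 0 \<Longrightarrow> Suc j = N"
proof (induction p arbitrary: N j)
  case 0
  thus ?case by (simp add: coeff_log_sy_div split: if_splits)
next
  case (Suc p)
  have e: "log_sy ^ Suc p * log_sy_div = log_sy * (log_sy ^ p * log_sy_div)" by (simp only: power_Suc mult.assoc)
  have "coeff ((log_sy * (log_sy ^ p * log_sy_div)) $ N) j \<noteq> 0" using Suc.prems unfolding e .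
  then obtain i a where "i \<le> N" "a \<le> j" "coeff (log_sy $ i) a * coeff ((log_sy ^ p * log_sy_div) $ (N - i)) (j - a) \<noteq> 0"
    unfolding fps_mult_nth[of log_sy] coeff_sum coeff_mult
    by (metis (no_types, lifting) sum.neutral atMost_iff atLeastAtMost_iff)
  thus ?case using Suc.IH[of "N - i" "j - a"] unfolding coeff_log_sy by (auto split: if_splits)
qed

text \<open>With \<open>j = k - 1\<close> and \<open>N = n - 1\<close> the hypotheses read
  \<open>2 \<le> k \<le> n - 2\<close>; they exclude the powers of \<open>s\<close> that carry the
  end terms of \<open>rser_bound\<close> and \<open>rser_lser_power_bound\<close>. The case
  \<open>m = 1\<close> is separate, since the Eulerian estimate would degenerate to 0 there.\<close>

lemma tcoef_add_shift_le:
  assumes "1 \<le> j" "j + 2 \<le> N"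
  shows "tcoef N j m + tcoef_shift N j m \<le> ucoef N j m"
proof (cases m)
  case 0
  then show ?thesis using assms by (simp add: tcoef_def tcoef_shift_def ucoef_def coeff_qser)
next
  case (Suc p)
  have sum: "tcoef N j m + tcoef_shift N j m = coeff (((1 + qser) * rser * lser ^ p) $ N) j / fact m"
  proof -
    have "(1 + qser) * rser * lser ^ p = qser * (rser * lser ^ p) + rser * lser ^ p"
      by (simp only: distrib_right mult_1_left mult.assoc add.commute)
    thus ?thesis unfolding tcoef_def tcoef_shift_def Suc by (simp only: fps_add_nth coeff_add) (simp add: add_divide_distrib)
  qed
  have "coeff (((1 + qser) * rser * lser ^ p) $ N) j \<le> coeff (eulerian m * (lam ^ m * qser) $ N) j"
  proof (cases "p = 0")
    case True
    have "coeff (((1 + qser) * rser) $ N) j \<le> coeff ((lam * qser + log_y + log_sy_div - fps_X) $ N) j"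
      using rser_bound unfolding fle_def by blast
    also have "\<dots> = coeff ((lam * qser) $ N) j"
      unfolding fps_add_nth fps_sub_nth coeff_add coeff_diff coeff_log_y coeff_log_sy_div coeff_fps_X using assms by auto
    finally show ?thesis using True Suc by simp
  next
    case False
    hence p1: "p \<ge> 1" by simp
    \<comment> \<open>Powers of \<open>log_y\<close> do not involve \<open>s\<close>.\<close>
    have y: "coeff ((log_y ^ Suc p) $ N) j = 0"
    proof -
      have "(log_y ^ r) $ i = [:coeff ((log_y ^ r) $ i) 0:]" for r i
      proof (induction r arbitrary: i)
        case (Suc r)
        have "(log_y ^ Suc r) $ i = (\<Sum>a=0..i. [:1 / real a:] * [:coeff ((log_y ^ r) $ (i - a)) 0:])"
          using Suc.IH by (simp add: fps_mult_nth log_y_def)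
        also have "\<dots> = [:\<Sum>a=0..i. 1 / real a * coeff ((log_y ^ r) $ (i - a)) 0:]"
          by (rule poly_eqI) (simp add: coeff_sum coeff_pCons split: nat.split)
        finally show ?case by simp
      qed (auto simp: one_pCons)
      from this[of "Suc p" N] show ?thesis using assms by (metis coeff_pCons_Suc coeff_0 not0_implies_Suc not_one_le_zero)
    qed
    have sy: "coeff ((log_sy ^ p * log_sy_div) $ N) j = 0"
      using coeff_log_sy_power_mult[of p N j] assms by fastforce
    let ?K = "2 * ((1 + svar) * lam) ^ p - lam ^ p - (svar * lam) ^ p"
    have "coeff (((1 + qser) * rser * lser ^ p) $ N) j \<le>
       coeff ((?K * (lam * qser) + log_y ^ Suc p + log_sy ^ p * log_sy_div) $ N) j"
      using rser_lser_power_bound[OF p1] unfolding fle_def by blast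
    also have "\<dots> = coeff ((?K * (lam * qser)) $ N) j"
      unfolding fps_add_nth coeff_add y sy by simp
    also have "?K * (lam * qser) = (2 * (1 + svar) ^ p - 1 - svar ^ p) * (lam ^ m * qser)"
    proof -
      have "(2 * (x * l) - l - u * l) * (k * r) = (2 * x - 1 - u) * (k * l * r)" for x l u k r :: "real poly fps"
        by (simp add: algebra_simps)
      thus ?thesis unfolding Suc power_mult_distrib power_Suc .
    qed
    also have "coeff (\<dots> $ N) j \<le> coeff ((fps_const (eulerian m) * (lam ^ m * qser)) $ N) j"
    proof -
      have "0 \<preceq> (fps_const (eulerian m) - (2 * (1 + svar) ^ p - 1 - svar ^ p)) * (lam ^ m * qser)"
        unfolding Suc using eulerian_bound[OF p1] fle_iff_diff
        by (intro nonneg_mult nonneg_power nonneg_series) blast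
      hence "(2 * (1 + svar) ^ p - 1 - svar ^ p) * (lam ^ m * qser) \<preceq> fps_const (eulerian m) * (lam ^ m * qser)"
        by (subst fle_iff_diff) (simp only: left_diff_distrib)
      thus ?thesis unfolding fle_def by blast
    qed
    finally show ?thesis by (simp only: fps_mult_left_const_nth)
  qed
  thus ?thesis unfolding sum ucoef_def by (simp add: divide_right_mono del: eulerian.simps)
qed

text \<open>For \<open>m \<ge> 1\<close>, the lowest-order parts \<open>y\<close> of
  \<open>rser\<close> and \<open>y (1 + s)\<close> of \<open>lser\<close> give the lower bound
  \<open>y ^ m (1 + s) ^ (m - 1) qser\<close>.\<close>

lemma tcoef_pos:
  assumes "j < N" "m \<le> N"
  shows "0 < tcoef N j m"
proof (cases m)
  case (Suc p)
  have X: "fps_X \<preceq> rser" unfolding fle_def coeff_fps_X coeff_rser by auto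
  have "fps_X * (1 + svar) \<preceq> lser"
    unfolding fle_def by (auto simp: distrib_left fps_X_mult_nth coeff_log_y coeff_log_sy_div coeff_pCons one_pCons split: nat.split)
  hence "(fps_X * (1 + svar)) ^ p \<preceq> lser ^ p"
    by (intro fle_power nonneg_mult nonneg_add nonneg_series nonneg_one)
  with X have "qser * (fps_X * (fps_X * (1 + svar)) ^ p) \<preceq> qser * (rser * lser ^ p)"
    by (intro fle_mult fle_refl nonneg_mult nonneg_add nonneg_power nonneg_series nonneg_one)
  hence "coeff ((qser * (rser * lser ^ p)) $ N) j \<ge> coeff ((qser * (fps_X * (fps_X * (1 + svar)) ^ p)) $ N) j"
    unfolding fle_def by blast
  also have "qser * (fps_X * (fps_X * (1 + svar)) ^ p) = fps_X ^ m * (fps_const ([:1, 1:] ^ p) * qser)"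
  proof -
    have "1 + svar = fps_const [:1, 1:]" by (rule fps_ext) (simp add: one_pCons)
    hence "(1 + svar) ^ p = fps_const ([:1, 1:] ^ p)" by (simp only: fps_const_power)
    thus ?thesis unfolding Suc power_mult_distrib by (simp only: power_Suc ac_simps)
  qed
  also have "coeff (\<dots> $ N) j = coeff ([:1, 1:] ^ p * qser $ (N - m)) j"
    using assms by (simp only: fps_X_power_mult_nth fps_mult_left_const_nth) simp
  finally have 1: "coeff ([:1, 1:] ^ p * qser $ (N - m)) j \<le> coeff ((qser * (rser * lser ^ p)) $ N) j" .
  \<comment> \<open>As many powers of \<open>s\<close> as possible come from
    \<open>(1 + s) ^ p\<close>; the rest is at most \<open>N - m\<close> because
    \<open>j < N\<close> and \<open>m \<le> N\<close>.\<close>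
  have 2: "coeff ([:1, 1:] ^ p) (min j p) * coeff (qser $ (N - m)) (j - min j p) \<le> coeff ([:1, 1:] ^ p * qser $ (N - m)) j"
    unfolding coeff_mult
  proof (rule member_le_sum)
    fix i
    show "0 \<le> coeff ([:1, 1:] ^ p) i * coeff (qser $ (N - m)) (j - i)"
      by (cases "i \<le> p") (auto simp: coeff_qser coeff_linear_poly_power coeff_eq_0 degree_linear_power)
  qed auto
  have "coeff ([:1, 1:] ^ p) (min j p) * coeff (qser $ (N - m)) (j - min j p) > 0"
    using assms Suc by (auto simp: coeff_qser coeff_linear_poly_power)
  hence "0 < coeff ((qser * (rser * lser ^ p)) $ N) j" using 1 2 by linarith
  thus ?thesis unfolding tcoef_def Suc by simp
qed (simp add: tcoef_def)

section \<open>Counting lattice points of boxes\<close>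

text \<open>Multiplied by the denominator \<open>1 + s - s y\<close> of \<open>rser\<close>, the
  series of both sides become \<open>qser ^ t - 1\<close> up to order \<open>N\<close>: the left by
  the exponential series of \<open>lser\<close>, the right as a geometric sum in
  \<open>qser\<close>.\<close>

lemma tcoef_shift_sum:
  assumes "j < N"
  shows "(\<Sum>m\<le>N. tcoef_shift N j m * real t ^ m) = (\<Sum>u<t. real (j + u choose u) * real (N - 1 - j + u choose u))"
proof -
  let ?d = "1 + svar - svar * fps_X"
  define V where "V = (\<Sum>m=1..N. fps_const [:real t ^ m / fact m:] * (rser * lser ^ (m - 1)))"
  define W where "W = (\<Sum>u<t. fps_X * qser ^ Suc u)"
  have dV: "?d * V = (\<Sum>m=1..N. fps_const [:real t ^ m / fact m:] * lser ^ m)"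
    unfolding V_def sum_distrib_left
  proof (rule sum.cong[OF refl])
    fix m assume "m \<in> {1..N}"
    hence "lser ^ m = lser * lser ^ (m - 1)" by (cases m) auto
    thus "?d * (fps_const [:real t ^ m / fact m:] * (rser * lser ^ (m - 1))) = fps_const [:real t ^ m / fact m:] * lser ^ m"
      unfolding rser_functional[symmetric] by (simp only: ac_simps)
  qed
  have q1: "?d * (fps_X * qser) = qser - 1"
  proof -
    have "(1 - fps_X) * geo_y * ((1 - svar * fps_X) * geo_sy) = 1"
      by (simp only: geo_y_inverse geo_sy_inverse mult_1_left)
    hence "qser - 1 = qser - (1 - fps_X) * (1 - svar * fps_X) * qser" by (simp only: ac_simps)
    thus ?thesis by (simp add: algebra_simps)
  qed
  have "?d * W = ?d * (fps_X * qser) * (\<Sum>u<t. qser ^ u)"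
    unfolding W_def sum_distrib_left by (simp only: power_Suc ac_simps)
  hence dW: "?d * W = qser ^ t - 1" unfolding q1 by (simp only: power_diff_1_eq)
  have l0: "lser $ 0 = 0" by (simp add: log_y_def log_sy_div_def)
  have q0: "qser $ 0 = 1" by (simp add: geo_y_def geo_sy_def)
  have low: "(?d * V) $ i = (?d * W) $ i" if "i \<le> N" for i
  proof -
    have "(qser ^ t) $ i = (\<Sum>m\<le>N. smult (real t ^ m / fact m) ((lser ^ m) $ i))"
      by (rule exp_series_nth[OF l0 q0 deriv_qser that, symmetric])
    also have "\<dots> = 1 $ i + (\<Sum>m=1..N. smult (real t ^ m / fact m) ((lser ^ m) $ i))"
      by (simp add: atMost_atLeast0 sum.atLeast_Suc_atMost[of 0])
    finally show ?thesis unfolding dV dW by (simp add: fps_sum_nth)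
  qed
  have d_nth: "(?d * F) $ i = [:1, 1:] * F $ i - [:0, 1:] * (if i = 0 then 0 else F $ (i - 1))" for F i
  proof -
    have "?d * F = F + svar * F - svar * (fps_X * F)" by (simp add: algebra_simps)
    thus ?thesis by (simp only: fps_add_nth fps_sub_nth fps_mult_left_const_nth fps_X_mult_nth) simp
  qed
  \<comment> \<open>The division by \<open>1 + s - s y\<close> goes coefficient by coefficient: its
    constant term \<open>1 + s\<close> can be cancelled but is not a unit among polynomials.\<close>
  have "V $ i = W $ i" if "i \<le> N" for i
    using that
  proof (induction i)
    case 0
    have "[:1, 1:] * V $ 0 = [:1, 1:] * W $ 0" using low[of 0] unfolding d_nth by simp
    then show ?case by (metis mult_left_cancel pCons_eq_0_iff one_neq_zero)
  next
    case (Suc i)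
    have "[:1, 1:] * V $ Suc i = [:1, 1:] * W $ Suc i" using low[of "Suc i"] Suc unfolding d_nth by simp
    then show ?case by (metis mult_left_cancel pCons_eq_0_iff one_neq_zero)
  qed
  hence VW: "V $ N = W $ N" by simp
  have "(\<Sum>m\<le>N. tcoef_shift N j m * real t ^ m) = (\<Sum>m=1..N. tcoef_shift N j m * real t ^ m)"
    by (rule sum.mono_neutral_right) (auto simp: tcoef_shift_def)
  also have "\<dots> = coeff (V $ N) j"
    unfolding V_def fps_sum_nth coeff_sum fps_mult_left_const_nth
    by (intro sum.cong refl) (simp add: tcoef_shift_def)
  also have "\<dots> = (\<Sum>u<t. coeff ((qser ^ Suc u) $ (N - 1)) j)"
    unfolding VW W_def fps_sum_nth coeff_sum fps_X_mult_nth using assms by simp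
  finally have "(\<Sum>m\<le>N. tcoef_shift N j m * real t ^ m) = (\<Sum>u<t. coeff ((qser ^ Suc u) $ (N - 1)) j)" .
  moreover have "j \<le> N - 1" using assms by simp
  ultimately show ?thesis by (simp only: coeff_qser_power if_True)
qed

text \<open>By \<open>qser_rser\<close> the excess of \<open>tcoef\<close> over
  \<open>tcoef_shift\<close> comes from \<open>fps_X * qser * lser ^ m\<close>, whose exponential
  series adds the summand \<open>u = t\<close>.\<close>

lemma tcoef_sum:
  assumes "j < N"
  shows "(\<Sum>m\<le>N. tcoef N j m * real t ^ m) = (\<Sum>u\<le>t. real (j + u choose u) * real (N - 1 - j + u choose u))"
proof -
  have l0: "lser $ 0 = 0" by (simp add: log_y_def log_sy_div_def)
  have q0: "qser $ 0 = 1" by (simp add: geo_y_def geo_sy_def)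
  have split: "tcoef N j m = tcoef_shift N j m + coeff ((lser ^ m * (fps_X * qser)) $ N) j / fact m" for m
  proof (cases m)
    case 0
    then show ?thesis using assms by (simp only: tcoef_def tcoef_shift_def power_0 mult_1_left fps_X_mult_nth) (simp add: coeff_qser)
  next
    case (Suc p)
    have "qser * (rser * lser ^ p) = (qser * rser) * lser ^ p" by (simp only: mult.assoc)
    also have "\<dots> = rser * lser ^ p + lser ^ m * (fps_X * qser)"
      unfolding qser_rser Suc power_Suc distrib_right[of rser] by (simp only: ac_simps)
    finally show ?thesis unfolding tcoef_def tcoef_shift_def Suc
      by (simp add: add_divide_distrib)
  qed
  have "(\<Sum>m\<le>N. tcoef N j m * real t ^ m) = (\<Sum>m\<le>N. tcoef_shift N j m * real t ^ m)
      + coeff (\<Sum>m\<le>N. smult (real t ^ m / fact m) ((lser ^ m * (fps_X * qser)) $ N)) j"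
    unfolding split coeff_sum coeff_smult distrib_right sum.distrib by (simp add: mult.commute)
  also have "coeff (\<Sum>m\<le>N. smult (real t ^ m / fact m) ((lser ^ m * (fps_X * qser)) $ N)) j
     = coeff ((qser ^ t * (fps_X * qser)) $ N) j"
    by (subst exp_series_mult_nth[OF l0 q0 deriv_qser order_refl]) (rule refl)
  also have "qser ^ t * (fps_X * qser) = fps_X * qser ^ Suc t" by (simp only: power_Suc ac_simps)
  also have "coeff (\<dots> $ N) j = real (j + t choose t) * real (N - 1 - j + t choose t)"
    unfolding fps_X_mult_nth using assms by (simp only: coeff_qser_power split: if_split) auto
  finally show ?thesis unfolding tcoef_shift_sum[OF assms] by (simp add: lessThan_Suc_atMost[symmetric])
qed

section \<open>Sums of bounded natural numbers\<close>

definition cnt :: "nat \<Rightarrow> nat \<Rightarrow> nat \<Rightarrow> real" where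
  "cnt m t p = ((Abs_fps (\<lambda>i. if i \<le> t then 1 else 0)) ^ m) $ p"

text \<open>Inclusion-exclusion over the parts exceeding \<open>t\<close>, obtained by writing the
  truncated geometric series as \<open>(1 - z ^ Suc t) / (1 - z)\<close>.\<close>

lemma cnt_formula:
  "cnt (Suc N) t p = (\<Sum>i\<le>Suc N. (-1) ^ i * real (Suc N choose i) *
      (if i * Suc t \<le> p then real (p - i * Suc t + N choose N) else 0))"
proof -
  define b where "b = (Abs_fps (\<lambda>i. if i \<le> t then 1 else 0) :: real fps)"
  define g where "g = (Abs_fps (\<lambda>n. 1) :: real fps)"
  have g: "(1 - fps_X) * g = 1" by (rule fps_ext) (simp add: g_def algebra_simps)
  have b: "(1 - fps_X) * b = 1 - fps_X ^ Suc t"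
    by (rule fps_ext) (auto simp: b_def algebra_simps fps_X_power_nth simp del: power_Suc)
  have "b = ((1 - fps_X) * b) * g" using g by (simp add: mult_ac)
  hence "b = (1 - fps_X ^ Suc t) * g" unfolding b .
  hence "b ^ Suc N = (1 - fps_X ^ Suc t) ^ Suc N * g ^ Suc N" by (simp only: power_mult_distrib)
  also have "(1 - fps_X ^ Suc t) ^ Suc N = (\<Sum>i\<le>Suc N. fps_const ((-1) ^ i * real (Suc N choose i)) * fps_X ^ (i * Suc t))"
  proof -
    have c: "fps_const ((-1) ^ i * real k) = of_nat k * (-1 :: real fps) ^ i" for i k
    proof -
      have "(-1 :: real fps) = fps_const (-1)" by (simp add: fps_const_neg[symmetric] del: fps_const_neg)
      hence "(-1 :: real fps) ^ i = fps_const ((-1) ^ i)" by (simp only: fps_const_power)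
      thus ?thesis by (simp add: fps_of_nat[symmetric] mult.commute)
    qed
    have "(1 - fps_X ^ Suc t) ^ Suc N = (- (fps_X ^ Suc t) + (1 :: real fps)) ^ Suc N" by simp
    also have "\<dots> = (\<Sum>i\<le>Suc N. of_nat (Suc N choose i) * (- (fps_X ^ Suc t)) ^ i)"
      by (simp only: binomial_ring power_one mult_1_right)
    also have "\<dots> = (\<Sum>i\<le>Suc N. fps_const ((-1) ^ i * real (Suc N choose i)) * fps_X ^ (i * Suc t))"
      unfolding c power_minus[of "fps_X ^ Suc t"] power_mult[symmetric] by (simp only: ac_simps)
    finally show ?thesis .
  qed
  finally have "cnt (Suc N) t p = (\<Sum>i\<le>Suc N. (fps_const ((-1) ^ i * real (Suc N choose i)) * (fps_X ^ (i * Suc t) * g ^ Suc N)) $ p)"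
    unfolding cnt_def b_def[symmetric] by (simp only: sum_distrib_right fps_sum_nth mult.assoc)
  thus ?thesis unfolding fps_mult_left_const_nth fps_X_power_mult_nth g_def geometric_power_nth
    by (auto intro!: sum.cong)
qed

text \<open>Terms with \<open>i > j\<close> vanish because \<open>Suc j * Suc t\<close> exceeds
  \<open>Suc j * t\<close>; reversing the summation turns the others into
  \<open>ucoef_sum\<close>.\<close>

lemma cnt_ucoef:
  assumes "j \<le> N"
  shows "cnt (Suc N) t (Suc j * t) = (\<Sum>m\<le>N. ucoef N j m * real t ^ m)"
proof -
  have "cnt (Suc N) t (Suc j * t) = (\<Sum>i\<le>j. (-1) ^ i * real (Suc N choose i) *
      (if i * Suc t \<le> Suc j * t then real (Suc j * t - i * Suc t + N choose N) else 0))"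
    unfolding cnt_formula
  proof (rule sum.mono_neutral_right)
    show "\<forall>i\<in>{..Suc N} - {..j}. (-1) ^ i * real (Suc N choose i) *
      (if i * Suc t \<le> Suc j * t then real (Suc j * t - i * Suc t + N choose N) else 0) = 0"
    proof
      fix i assume "i \<in> {..Suc N} - {..j}"
      hence "Suc j * Suc t \<le> i * Suc t" by (intro mult_le_mono) auto
      hence "\<not> i * Suc t \<le> Suc j * t" by simp
      thus "(-1) ^ i * real (Suc N choose i) *
      (if i * Suc t \<le> Suc j * t then real (Suc j * t - i * Suc t + N choose N) else 0) = 0" by simp
    qed
  qed (use assms in auto)
  also have "\<dots> = (\<Sum>i\<le>j. (-1) ^ (j - i) * real (Suc N choose (j - i)) *
        (if j - i \<le> Suc i * t then real (Suc i * t - (j - i) + N choose N) else 0))"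
  proof (rule sum.reindex_bij_witness[of _ "\<lambda>i. j - i" "\<lambda>i. j - i"])
    fix i assume i: "i \<in> {..j}"
    then obtain d where d: "j = i + d" by (auto simp: le_iff_add)
    have 1: "(j - (j - i) \<le> Suc (j - i) * t) = (i * Suc t \<le> Suc j * t)" unfolding d by (simp add: algebra_simps)
    have 2: "Suc (j - i) * t - (j - (j - i)) = Suc j * t - i * Suc t" unfolding d by (simp add: algebra_simps)
    show "(-1) ^ (j - (j - i)) * real (Suc N choose (j - (j - i))) *
        (if j - (j - i) \<le> Suc (j - i) * t then real (Suc (j - i) * t - (j - (j - i)) + N choose N) else 0)
       = (-1) ^ i * real (Suc N choose i) *
      (if i * Suc t \<le> Suc j * t then real (Suc j * t - i * Suc t + N choose N) else 0)"
      unfolding 1 2 using i by simp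
  qed auto
  finally show ?thesis unfolding ucoef_sum[OF assms] .
qed

text \<open>A total of at most \<open>t\<close> never meets the bound on the parts, so only the term
  \<open>i = 0\<close> survives.\<close>

lemma cnt_low:
  assumes "p \<le> t"
  shows "cnt (Suc N) t p = real (N + p choose p)"
proof -
  have "cnt (Suc N) t p = (\<Sum>i\<le>Suc N. if i = 0 then real (p + N choose N) else 0)"
    unfolding cnt_formula
  proof (intro sum.cong refl)
    fix i
    have "\<not> i * Suc t \<le> p" if "i \<noteq> 0" using assms that mult_le_mono1[of 1 i "Suc t"] by simp
    thus "(-1) ^ i * real (Suc N choose i) * (if i * Suc t \<le> p then real (p - i * Suc t + N choose N) else 0)
       = (if i = 0 then real (p + N choose N) else 0)" by auto
  qed
  also have "\<dots> = real (p + N choose N)" by simp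
  also have "(p + N choose N) = (N + p choose p)" using binomial_symmetric[of N "p + N"] by (simp add: add.commute)
  finally show ?thesis .
qed

section \<open>Lattice points in slices of a box\<close>

definition boxed :: "nat set \<Rightarrow> nat \<Rightarrow> (nat \<Rightarrow> int) set" where
  "boxed A t = {x. (\<forall>i\<in>A. 0 \<le> x i \<and> x i \<le> int t) \<and> (\<forall>i. i \<notin> A \<longrightarrow> x i = 0)}"

definition slice :: "nat set \<Rightarrow> nat \<Rightarrow> nat \<Rightarrow> (nat \<Rightarrow> int) set" where
  "slice A t p = {x \<in> boxed A t. sum x A = int p}"

lemma finite_boxed: "finite A \<Longrightarrow> finite (boxed A t)"
proof -
  assume "finite A"
  hence "finite {f. \<forall>x. (x \<in> A \<longrightarrow> f x \<in> {0..int t}) \<and> (x \<notin> A \<longrightarrow> f x = (0::int))}"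
    by (rule finite_set_of_finite_funs) auto
  thus ?thesis by (rule rev_finite_subset) (auto simp: boxed_def)
qed

lemma finite_slice: "finite A \<Longrightarrow> finite (slice A t p)"
  by (simp add: slice_def finite_boxed)

lemma slice_insert:
  assumes "finite A" "a \<notin> A"
  shows "slice (insert a A) t p = (\<Union>v\<in>{0..min t p}. (\<lambda>x. x(a := int v)) ` slice A t (p - v))"
proof (intro equalityI subsetI)
  fix x assume x: "x \<in> slice (insert a A) t p"
  define v where "v = nat (x a)"
  have v: "int v = x a" "v \<le> t" using x by (auto simp: v_def slice_def boxed_def)
  have s: "x a + sum x A = int p" using x assms by (simp add: slice_def)
  have "sum x A \<ge> 0" using x by (intro sum_nonneg) (auto simp: slice_def boxed_def)
  hence vp: "v \<le> p" using s v by linarith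
  have "x(a := 0) \<in> slice A t (p - v)"
  proof -
    have "sum (x(a := 0)) A = sum x A" using assms by (intro sum.cong) auto
    thus ?thesis using x s v vp assms by (auto simp: slice_def boxed_def)
  qed
  moreover have "x = (x(a := 0))(a := int v)" using v by auto
  ultimately show "x \<in> (\<Union>v\<in>{0..min t p}. (\<lambda>x. x(a := int v)) ` slice A t (p - v))"
    using v vp by (intro UN_I[of v] image_eqI) auto
next
  fix x assume "x \<in> (\<Union>v\<in>{0..min t p}. (\<lambda>x. x(a := int v)) ` slice A t (p - v))"
  then obtain v y where v: "v \<le> t" "v \<le> p" and y: "y \<in> slice A t (p - v)" and x: "x = y(a := int v)" by auto
  have "sum x A = sum y A" unfolding x using assms by (intro sum.cong) auto
  thus "x \<in> slice (insert a A) t p" using v y assms by (auto simp: slice_def boxed_def x)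
qed

lemma card_slice: "finite A \<Longrightarrow> real (card (slice A t p)) = cnt (card A) t p"
proof (induction A arbitrary: p rule: finite_induct)
  case empty
  have "slice {} t p = (if p = 0 then {\<lambda>_. 0} else {})" by (auto simp: slice_def boxed_def)
  then show ?case by (simp add: cnt_def)
next
  case (insert a A)
  have inj: "inj_on (\<lambda>x. x(a := int v)) (slice A t q)" for v q
  proof (rule inj_onI)
    fix x y assume h: "x \<in> slice A t q" "y \<in> slice A t q" "x(a := int v) = y(a := int v)"
    show "x = y"
    proof
      fix i show "x i = y i" using h insert.hyps by (cases "i = a") (simp_all add: slice_def boxed_def, metis fun_upd_other)
    qed
  qed
  have "card (slice (insert a A) t p) = (\<Sum>v=0..min t p. card ((\<lambda>x. x(a := int v)) ` slice A t (p - v)))"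
    unfolding slice_insert[OF insert.hyps]
  proof (rule card_UN_disjoint)
    show "\<forall>i\<in>{0..min t p}. \<forall>j\<in>{0..min t p}. i \<noteq> j \<longrightarrow>
       (\<lambda>x. x(a := int i)) ` slice A t (p - i) \<inter> (\<lambda>x. x(a := int j)) ` slice A t (p - j) = {}"
      by (auto dest: fun_cong[where x = a])
  qed (use insert.hyps finite_slice in auto)
  hence "real (card (slice (insert a A) t p)) = (\<Sum>v=0..min t p. cnt (card A) t (p - v))"
    by (simp add: card_image[OF inj] insert.IH)
  also have "\<dots> = (\<Sum>v=0..p. (if v \<le> t then 1 else 0) * cnt (card A) t (p - v))"
    by (rule sum.mono_neutral_cong_left) auto
  also have "\<dots> = cnt (card (insert a A)) t p"
    using insert.hyps by (simp add: cnt_def fps_mult_nth)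
  finally show ?case .
qed

text \<open>Reflecting each coordinate, \<open>t - x i\<close> for \<open>x i\<close>, exchanges the
  two slices.\<close>

lemma cnt_symmetric:
  assumes "p \<le> m * t"
  shows "cnt m t (m * t - p) = cnt m t p"
proof -
  let ?A = "{..<m}"
  let ?f = "\<lambda>(x :: nat \<Rightarrow> int) i. if i < m then int t - x i else 0"
  have "bij_betw ?f (slice ?A t (m * t - p)) (slice ?A t p)"
    by (rule bij_betwI[where g = ?f])
      (use assms in \<open>auto simp: slice_def boxed_def sum_subtractf of_nat_diff\<close>)
  hence "card (slice ?A t (m * t - p)) = card (slice ?A t p)" by (rule bij_betw_same_card)
  thus ?thesis using card_slice[of ?A] by (metis card_lessThan finite_lessThan)
qed

lemma card_slice_pair:
  assumes "finite A" "finite B" "A \<inter> B = {}"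
  shows "real (card {x \<in> boxed (A \<union> B) t. sum x A = int p \<and> sum x B = int q}) = cnt (card A) t p * cnt (card B) t q"
proof -
  let ?f = "\<lambda>x i. if i \<in> A then x i else (0 :: int)" and ?g = "\<lambda>x i. if i \<in> B then x i else (0 :: int)"
  have sf: "sum (?f x) A = sum x A" "sum (?g x) B = sum x B" for x by (auto intro: sum.cong)
  have "bij_betw (\<lambda>x. (?f x, ?g x)) {x \<in> boxed (A \<union> B) t. sum x A = int p \<and> sum x B = int q} (slice A t p \<times> slice B t q)"
  proof (rule bij_betwI[where g = "\<lambda>(y, z) i. y i + z i"])
    show "(\<lambda>x. (?f x, ?g x)) \<in> {x \<in> boxed (A \<union> B) t. sum x A = int p \<and> sum x B = int q} \<rightarrow> slice A t p \<times> slice B t q"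
      using assms by (auto simp: slice_def boxed_def sf)
    show "(\<lambda>(y, z) i. y i + z i) \<in> slice A t p \<times> slice B t q \<rightarrow> {x \<in> boxed (A \<union> B) t. sum x A = int p \<and> sum x B = int q}"
    proof safe
      fix y z assume yz: "y \<in> slice A t p" "z \<in> slice B t q"
      have "z i = 0" if "i \<in> A" for i using yz that assms by (auto simp: slice_def boxed_def)
      moreover have "y i = 0" if "i \<in> B" for i using yz that assms by (auto simp: slice_def boxed_def)
      moreover have y: "(\<Sum>i\<in>A. y i + z i) = sum y A" "(\<Sum>i\<in>B. y i + z i) = sum z B"
        using calculation by (auto intro: sum.cong)
      ultimately show "(\<lambda>i. y i + z i) \<in> boxed (A \<union> B) t" "(\<Sum>i\<in>A. y i + z i) = int p" "(\<Sum>i\<in>B. y i + z i) = int q"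
        using yz assms by (auto simp: slice_def boxed_def)
    qed
  qed (use assms in \<open>auto simp: slice_def boxed_def fun_eq_iff disjoint_iff\<close>, blast)
  hence "card {x \<in> boxed (A \<union> B) t. sum x A = int p \<and> sum x B = int q} = card (slice A t p \<times> slice B t q)"
    by (rule bij_betw_same_card)
  thus ?thesis using card_slice[OF assms(1)] card_slice[OF assms(2)] by (simp add: card_cartesian_product)
qed

section \<open>Bases and lattice points\<close>

lemma nth_sorted_list_le_iff:
  assumes "finite T" "i < card T"
  shows "sorted_list_of_set T ! i \<le> m \<longleftrightarrow> i < card (T \<inter> {..m :: nat})"
proof -
  define xs where "xs = sorted_list_of_set T"
  have xs: "sorted xs" "distinct xs" "set xs = T" "length xs = card T" using assms by (simp_all add: xs_def)
  have c: "card (T \<inter> {..m}) = card {j. j < length xs \<and> xs ! j \<le> m}"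
  proof -
    have "T \<inter> {..m} = (\<lambda>j. xs ! j) ` {j. j < length xs \<and> xs ! j \<le> m}"
      using xs(3) by (auto simp: set_conv_nth)
    moreover have "inj_on (\<lambda>j. xs ! j) {j. j < length xs \<and> xs ! j \<le> m}"
      using xs(2) by (auto simp: inj_on_def nth_eq_iff_index_eq)
    ultimately show ?thesis by (simp add: card_image)
  qed
  show ?thesis
  proof (cases "xs ! i \<le> m")
    case True
    have "{..i} \<subseteq> {j. j < length xs \<and> xs ! j \<le> m}"
      using True xs assms by (auto intro: order_trans[OF sorted_nth_mono])
    hence "card {..i} \<le> card {j. j < length xs \<and> xs ! j \<le> m}" by (intro card_mono) auto
    thus ?thesis using True c unfolding xs_def by simp
  next
    case False
    have "{j. j < length xs \<and> xs ! j \<le> m} \<subseteq> {..<i}"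
    proof
      fix j assume j: "j \<in> {j. j < length xs \<and> xs ! j \<le> m}"
      have "\<not> i \<le> j" using sorted_nth_mono[OF xs(1), of i j] j False by auto
      thus "j \<in> {..<i}" by simp
    qed
    hence "card {j. j < length xs \<and> xs ! j \<le> m} \<le> card {..<i}" by (intro card_mono) auto
    thus ?thesis using False c unfolding xs_def by simp
  qed
qed

text \<open>The list entry at index \<open>i\<close> is at most \<open>m\<close> iff more than
  \<open>i\<close> elements are, so comparing sorted lists amounts to comparing prefix counts, which
  are linear in indicator vectors.\<close>

lemma gale_le_iff_card:
  assumes "finite T" "finite S" "card T = card S"
  shows "gale_le T S \<longleftrightarrow> (\<forall>m. card (S \<inter> {..m}) \<le> card (T \<inter> {..m}))"
proof
  assume g: "gale_le T S"
  show "\<forall>m. card (S \<inter> {..m}) \<le> card (T \<inter> {..m})"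
  proof
    fix m
    show "card (S \<inter> {..m}) \<le> card (T \<inter> {..m})"
    proof (cases "card (S \<inter> {..m})")
      case (Suc i)
      have i: "i < card S" using Suc card_mono[of S "S \<inter> {..m}"] assms by simp
      hence "sorted_list_of_set T ! i \<le> sorted_list_of_set S ! i" using g by (auto simp: gale_le_def)
      also have "\<dots> \<le> m" using nth_sorted_list_le_iff[of S i m] i Suc assms by simp
      finally show ?thesis using nth_sorted_list_le_iff[of T i m] i assms Suc by simp
    qed simp
  qed
next
  assume h: "\<forall>m. card (S \<inter> {..m}) \<le> card (T \<inter> {..m})"
  have "sorted_list_of_set T ! i \<le> sorted_list_of_set S ! i" if i: "i < card S" for i
  proof -
    have "i < card (S \<inter> {..sorted_list_of_set S ! i})"
      using nth_sorted_list_le_iff[of S i] i assms by blast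
    also have "\<dots> \<le> card (T \<inter> {..sorted_list_of_set S ! i})" using h by blast
    finally show ?thesis using nth_sorted_list_le_iff[of T i] i assms by simp
  qed
  thus "gale_le T S" using assms by (auto simp: gale_le_def)
qed

definition cut_bases :: "nat \<Rightarrow> nat \<Rightarrow> nat \<Rightarrow> nat \<Rightarrow> nat set set" where
  "cut_bases n k r c = {T. T \<subseteq> {1..n} \<and> card T = r \<and> c \<le> card (T \<inter> {..k})}"

lemma card_atMost_mono_add:
  assumes "finite T" "m \<le> m'"
  shows "card (T \<inter> {..m'}) \<le> card (T \<inter> {..m}) + (m' - m)"
proof -
  have "T \<inter> {..m'} \<subseteq> (T \<inter> {..m}) \<union> {m<..m'}" by auto
  hence "card (T \<inter> {..m'}) \<le> card ((T \<inter> {..m}) \<union> {m<..m'})" using assms by (intro card_mono) auto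
  also have "\<dots> \<le> card (T \<inter> {..m}) + card {m<..m'}" by (rule card_Un_le)
  finally show ?thesis by simp
qed

text \<open>For the three sets in question one prefix condition, at \<open>k\<close>, is binding;
  \<open>sufficient\<close> asks that it imply all others.\<close>

lemma schubert_bases_cut:
  assumes S: "finite S" "card S = r"
    and necessary: "c \<le> card (S \<inter> {..k})"
    and sufficient: "\<And>T m. T \<subseteq> {1..n} \<Longrightarrow> card T = r \<Longrightarrow> c \<le> card (T \<inter> {..k}) \<Longrightarrow> card (S \<inter> {..m}) \<le> card (T \<inter> {..m})"
  shows "schubert_bases n S = cut_bases n k r c"
proof (intro equalityI subsetI)
  fix T assume T: "T \<in> schubert_bases n S"
  hence f: "finite T" "card T = card S" by (auto simp: schubert_bases_def gale_le_def)
  have "card (S \<inter> {..k}) \<le> card (T \<inter> {..k})" using T gale_le_iff_card[OF f(1) S(1) f(2)] by (simp add: schubert_bases_def)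
  thus "T \<in> cut_bases n k r c" using T S necessary f by (simp add: schubert_bases_def cut_bases_def)
next
  fix T assume T: "T \<in> cut_bases n k r c"
  hence f: "finite T" "card T = card S" using S finite_subset[of T "{1..n}"] by (auto simp: cut_bases_def)
  thus "T \<in> schubert_bases n S" using T sufficient gale_le_iff_card[OF f(1) S(1) f(2)]
    by (simp add: schubert_bases_def cut_bases_def)
qed

lemma card_beyond:
  assumes "T \<subseteq> {1..n}"
  shows "card T \<le> card (T \<inter> {..m}) + (n - m)"
proof (cases "m \<le> n")
  case True
  have "T \<inter> {..n} = T" using assms by auto
  thus ?thesis using card_atMost_mono_add[of T m n] assms True finite_subset[of T "{1..n}"] by auto
next
  case False
  hence "T \<inter> {..m} = T" using assms by auto
  thus ?thesis by simp
qed

lemma schubert_bases_uniform: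
  assumes "k \<le> n"
  shows "schubert_bases n (uniform_set k n) = cut_bases n l k 0"
proof (rule schubert_bases_cut)
  fix T m assume T: "T \<subseteq> {1..n}" "card T = k"
  have "uniform_set k n \<inter> {..m} = {n - k + 1..min m n}" unfolding uniform_set_def by auto
  hence "card (uniform_set k n \<inter> {..m}) = min m n - (n - k)" by simp
  thus "card (uniform_set k n \<inter> {..m}) \<le> card (T \<inter> {..m})" using card_beyond[OF T(1), of m] T(2) by linarith
qed (use assms in \<open>auto simp: uniform_set_def\<close>)

text \<open>The rank is \<open>n - k\<close> here. For \<open>k \<le> m \<le> n\<close> the required
  prefix count is \<open>max 1 (m - k)\<close>: the cut supplies the 1 and
  \<open>card_beyond\<close> the rest.\<close>

lemma schubert_bases_sp:
  assumes "1 \<le> k" "k + 2 \<le> n"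
  shows "schubert_bases n (sp_set k n) = cut_bases n k (n - k) 1"
proof (rule schubert_bases_cut)
  show "finite (sp_set k n)" "card (sp_set k n) = n - k" using assms by (auto simp: sp_set_def)
  have "sp_set k n \<inter> {..k} = {k}" by (auto simp: sp_set_def)
  thus "1 \<le> card (sp_set k n \<inter> {..k})" by simp
  fix T m assume T: "T \<subseteq> {1..n}" "card T = n - k" "1 \<le> card (T \<inter> {..k})"
  show "card (sp_set k n \<inter> {..m}) \<le> card (T \<inter> {..m})"
  proof (cases "m < k")
    case True
    hence "sp_set k n \<inter> {..m} = {}" by (auto simp: sp_set_def)
    thus ?thesis by simp
  next
    case False
    have "finite T" using T(1) finite_subset by blast
    hence "card (T \<inter> {..k}) \<le> card (T \<inter> {..m})" using False by (intro card_mono) auto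
    moreover have "sp_set k n \<inter> {..m} = insert k {k + 2..min m n}" using False by (auto simp: sp_set_def)
    hence "card (sp_set k n \<inter> {..m}) = Suc (min m n - Suc k)" by simp
    ultimately show ?thesis using card_beyond[OF T(1), of m] T(2,3) by linarith
  qed
qed

text \<open>Going down from \<open>k\<close> to \<open>m\<close> loses at most \<open>k - m\<close>
  elements, so the cut gives the bound \<open>m - 1\<close> below \<open>k\<close>; from
  \<open>k\<close> up to \<open>n - 1\<close> the required count stays \<open>k - 1\<close>.\<close>

lemma schubert_bases_minimal:
  assumes "1 \<le> k" "k + 2 \<le> n"
  shows "schubert_bases n (minimal_set k n) = cut_bases n k k (k - 1)"
proof (rule schubert_bases_cut)
  show "finite (minimal_set k n)" "card (minimal_set k n) = k" using assms by (auto simp: minimal_set_def)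
  have "minimal_set k n \<inter> {..k} = {2..k}" using assms by (auto simp: minimal_set_def)
  thus "k - 1 \<le> card (minimal_set k n \<inter> {..k})" by simp
  fix T m assume T: "T \<subseteq> {1..n}" "card T = k" "k - 1 \<le> card (T \<inter> {..k})"
  have f: "finite T" using T(1) finite_subset by blast
  consider "m \<le> k" | "k \<le> m" "m < n" | "n \<le> m" by linarith
  thus "card (minimal_set k n \<inter> {..m}) \<le> card (T \<inter> {..m})"
  proof cases
    case 1
    hence "minimal_set k n \<inter> {..m} = {2..m}" using assms by (auto simp: minimal_set_def)
    thus ?thesis using card_atMost_mono_add[OF f 1] T(3) 1 by simp
  next
    case 2
    hence "minimal_set k n \<inter> {..m} = {2..k}" using assms by (auto simp: minimal_set_def)
    moreover have "card (T \<inter> {..k}) \<le> card (T \<inter> {..m})" using f 2 by (intro card_mono) auto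
    ultimately show ?thesis using T(3) by simp
  next
    case 3
    hence "minimal_set k n \<inter> {..m} = minimal_set k n" using assms by (auto simp: minimal_set_def)
    moreover have "T \<inter> {..m} = T" using T(1) 3 by auto
    ultimately show ?thesis using T(2) \<open>card (minimal_set k n) = k\<close> by simp
  qed
qed

section \<open>Integer decomposition of the dilates\<close>

definition cut_points :: "nat \<Rightarrow> nat \<Rightarrow> nat \<Rightarrow> nat \<Rightarrow> nat \<Rightarrow> (nat \<Rightarrow> int) set" where
  "cut_points n k r c t = {x. (\<forall>i\<in>{1..n}. 0 \<le> x i \<and> x i \<le> int t) \<and> (\<forall>i. i \<notin> {1..n} \<longrightarrow> x i = 0) \<and>
     sum x {1..n} = int (r * t) \<and> int (c * t) \<le> sum x {1..k}}"

lemma sum_indicator_card: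
  assumes "finite A"
  shows "(\<Sum>i\<in>A. if i \<in> B then 1 else (0::int)) = int (card (B \<inter> A))"
proof -
  have "(\<Sum>i\<in>A. if i \<in> B then 1 else (0::int)) = (\<Sum>i\<in>B \<inter> A. 1)"
    using assms by (intro sum.mono_neutral_cong_right) auto
  thus ?thesis by simp
qed

lemma cut_bases_inter: "T \<in> cut_bases n k r c \<Longrightarrow> T \<inter> {..k} = T \<inter> {1..k}"
  by (auto simp: cut_bases_def)

text \<open>A set that contains all entries of maximal value and avoids all zeros can be subtracted
  without leaving the box of side \<open>t\<close>; the bounds on \<open>d\<close> make room for one
  of that size.\<close>

lemma select_between:
  fixes x :: "nat \<Rightarrow> int"
  assumes "finite A" "\<And>i. i \<in> A \<Longrightarrow> 0 \<le> x i \<and> x i \<le> int (Suc t)"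
    and "int (card {i\<in>A. x i = int (Suc t)}) \<le> int d" and "int d \<le> int (card {i\<in>A. 1 \<le> x i})"
  shows "\<exists>B\<subseteq>A. card B = d \<and> (\<forall>i\<in>B. 1 \<le> x i) \<and> (\<forall>i\<in>A - B. x i \<le> int t)"
proof -
  have "\<exists>B. {i\<in>A. x i = int (Suc t)} \<subseteq> B \<and> B \<subseteq> {i\<in>A. 1 \<le> x i} \<and> card B = d"
    by (rule exists_subset_between) (use assms in auto)
  then obtain B where B: "{i\<in>A. x i = int (Suc t)} \<subseteq> B" "B \<subseteq> {i\<in>A. 1 \<le> x i}" "card B = d" by blast
  have "x i \<le> int t" if "i \<in> A - B" for i
  proof -
    have "x i \<noteq> int (Suc t)" "x i \<le> int (Suc t)" using that B assms(2) by auto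
    thus ?thesis by simp
  qed
  with B show ?thesis by (intro exI[of _ B]) auto
qed

lemma card_full_le_sum:
  fixes x :: "nat \<Rightarrow> int"
  assumes "finite A" "\<And>i. i \<in> A \<Longrightarrow> 0 \<le> x i \<and> x i \<le> int (Suc t)"
  shows "int (card {i\<in>A. x i = int (Suc t)}) * int (Suc t) \<le> sum x A"
    and "sum x A \<le> int (card {i\<in>A. 1 \<le> x i}) * int (Suc t)"
proof -
  have "int (card {i\<in>A. x i = int (Suc t)}) * int (Suc t) = (\<Sum>i\<in>{i\<in>A. x i = int (Suc t)}. x i)" by simp
  also have "\<dots> \<le> sum x A" using assms by (intro sum_mono2) auto
  finally show "int (card {i\<in>A. x i = int (Suc t)}) * int (Suc t) \<le> sum x A" .
  have "sum x A = sum x {i\<in>A. 1 \<le> x i}" using assms by (intro sum.mono_neutral_right) force+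
  also have "\<dots> \<le> (\<Sum>i\<in>{i\<in>A. 1 \<le> x i}. int (Suc t))" using assms by (intro sum_mono) auto
  finally show "sum x A \<le> int (card {i\<in>A. 1 \<le> x i}) * int (Suc t)" by simp
qed

text \<open>Choosing \<open>\<lfloor>(x_1 + \<dots> + x_k) / (t + 1)\<rfloor>\<close> elements of the basis inside \<open>{1..k}\<close> keeps all constraints
  after subtracting its indicator vector.\<close>

lemma peel_basis:
  assumes x: "x \<in> cut_points n k r c (Suc t)" and "k \<le> n"
  obtains B where "B \<in> cut_bases n k r c" "(\<lambda>i. x i - (if i \<in> B then 1 else 0)) \<in> cut_points n k r c t"
proof -
  let ?A = "{1..k}" and ?A' = "{Suc k..n}" and ?T = "int (Suc t)"
  define \<sigma> where "\<sigma> = sum x ?A"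
  define d where "d = nat (\<sigma> div ?T)"
  have un: "{1..n} = ?A \<union> ?A'" using \<open>k \<le> n\<close> by auto
  have bd: "0 \<le> x i \<and> x i \<le> ?T" if "i \<in> {1..n}" for i using x that by (auto simp: cut_points_def)
  have bA: "0 \<le> x i \<and> x i \<le> ?T" if "i \<in> ?A" for i using bd that \<open>k \<le> n\<close> by auto
  have bA': "0 \<le> x i \<and> x i \<le> ?T" if "i \<in> ?A'" for i using bd that by auto
  have tot: "sum x ?A' = int r * ?T - \<sigma>"
  proof -
    have "sum x {1..n} = sum x ?A + sum x ?A'" unfolding un by (intro sum.union_disjoint) auto
    thus ?thesis using x by (simp add: cut_points_def \<sigma>_def algebra_simps)
  qed
  have c: "int c * ?T \<le> \<sigma>" using x by (simp add: cut_points_def \<sigma>_def algebra_simps)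
  have \<sigma>0: "0 \<le> \<sigma>" unfolding \<sigma>_def using bA by (intro sum_nonneg) auto
  hence d: "int d = \<sigma> div ?T" by (simp add: d_def pos_imp_zdiv_nonneg_iff)
  have d1: "int d * ?T \<le> \<sigma>" and d2: "\<sigma> < (int d + 1) * ?T"
  proof -
    have e: "int d * ?T = \<sigma> - \<sigma> mod ?T" unfolding d by (rule minus_mod_eq_div_mult[symmetric])
    have m: "0 \<le> \<sigma> mod ?T" "\<sigma> mod ?T < ?T" by simp_all
    show "int d * ?T \<le> \<sigma>" unfolding e using m by linarith
    show "\<sigma> < (int d + 1) * ?T" unfolding distrib_right mult_1_left e using m by linarith
  qed
  have canc: "a < b + 1" if "a * ?T < (b + 1) * ?T" for a b :: int
    using that mult_less_cancel_right_pos[of ?T a "b + 1"] by simp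
  have cancel: "a \<le> b" if "a * ?T \<le> b * ?T" for a b :: int
    using that mult_le_cancel_right_pos[of ?T a b] by simp
  note fA = card_full_le_sum[of ?A x t, OF finite_atLeastAtMost bA, folded \<sigma>_def] and fA' = card_full_le_sum[of ?A' x t, OF finite_atLeastAtMost bA', unfolded tot]
  have cd: "c \<le> d" using canc[OF le_less_trans[OF c d2]] by simp
  have dr: "d \<le> r"
  proof -
    have "0 \<le> sum x ?A'" using bA' by (intro sum_nonneg) auto
    hence "int d * ?T \<le> int r * ?T" using tot d1 by linarith
    from cancel[OF this] show ?thesis by simp
  qed
  have rd: "int (r - d) * ?T = int r * ?T - int d * ?T"
    unfolding of_nat_diff[OF dr] by (rule left_diff_distrib)
  \<comment> \<open>With \<open>T = t + 1\<close>, comparing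
    \<open>d T \<le> \<sigma> < (d + 1) T\<close> with the sums over maximal and over nonzero
    entries makes room for \<open>d\<close> elements inside \<open>{1..k}\<close> and
    \<open>r - d\<close> outside.\<close>
  have i1: "int (card {i\<in>?A. x i = ?T}) \<le> int d"
    using canc[OF le_less_trans[OF fA(1) d2]] by simp
  have i2: "int d \<le> int (card {i\<in>?A. 1 \<le> x i})"
    by (rule cancel[OF order_trans[OF d1 fA(2)]])
  have "int (card {i\<in>?A'. x i = ?T}) * ?T \<le> int (r - d) * ?T"
    using fA'(1) d1 unfolding rd by linarith
  note i3 = cancel[OF this]
  have "int (r - d) * ?T < (int (card {i\<in>?A'. 1 \<le> x i}) + 1) * ?T"
    using fA'(2) d2 unfolding rd distrib_right mult_1_left by linarith
  from canc[OF this] have i4: "int (r - d) \<le> int (card {i\<in>?A'. 1 \<le> x i})" by simp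
  obtain B1 where B1: "B1 \<subseteq> ?A" "card B1 = d" "\<forall>i\<in>B1. 1 \<le> x i" "\<forall>i\<in>?A - B1. x i \<le> int t"
    using select_between[OF finite_atLeastAtMost bA i1 i2] by blast
  obtain B2 where B2: "B2 \<subseteq> ?A'" "card B2 = r - d" "\<forall>i\<in>B2. 1 \<le> x i" "\<forall>i\<in>?A' - B2. x i \<le> int t"
    using select_between[OF finite_atLeastAtMost bA' i3 i4] by blast
  let ?B = "B1 \<union> B2" and ?y = "\<lambda>i. x i - (if i \<in> B1 \<union> B2 then 1 else 0)"
  have fin: "finite B1" "finite B2" using B1(1) B2(1) finite_subset by auto
  have e1: "1 \<le> i \<and> i \<le> k" if "i \<in> B1" for i using B1(1) that by auto
  have e2: "k < i \<and> i \<le> n" if "i \<in> B2" for i using B2(1) that by auto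
  have "B1 \<inter> B2 = {}" using e1 e2 by fastforce
  hence cB: "card ?B = r" using fin B1(2) B2(2) dr by (simp add: card_Un_disjoint)
  have BA: "?B \<inter> {1..k} = B1" "?B \<inter> {..k} = B1" "?B \<inter> {1..n} = ?B"
    using e1 e2 \<open>k \<le> n\<close> by fastforce+
  have "?B \<subseteq> {1..n}" using BA(3) by blast
  hence B: "?B \<in> cut_bases n k r c"
    unfolding cut_bases_def mem_Collect_eq BA(2) cB B1(2) using cd by blast
  have "sum x {1..n} = int r * ?T" using x by (simp only: cut_points_def mem_Collect_eq of_nat_mult)
  hence "sum ?y {1..n} = int r * ?T - int r"
    unfolding sum_subtractf sum_indicator_card[OF finite_atLeastAtMost] BA cB by (simp only:)
  hence s1: "sum ?y {1..n} = int (r * t)" by (simp add: algebra_simps)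
  have "sum ?y {1..k} = \<sigma> - int d"
    unfolding sum_subtractf sum_indicator_card[OF finite_atLeastAtMost] BA B1(2) \<sigma>_def ..
  moreover have "int (c * t) \<le> int (d * t)" using cd by (simp only: of_nat_le_iff mult_le_mono1)
  moreover have "int (d * t) + int d \<le> \<sigma>" using d1 by (simp add: algebra_simps)
  ultimately have s2: "int (c * t) \<le> sum ?y {1..k}" by linarith
  have "0 \<le> ?y i \<and> ?y i \<le> int t" if "i \<in> {1..n}" for i
  proof -
    have "i \<in> ?A \<or> i \<in> ?A'" using that by auto
    hence "i \<notin> ?B \<Longrightarrow> x i \<le> int t" using B1(4) B2(4) by blast
    moreover have "i \<in> ?B \<Longrightarrow> 1 \<le> x i" using B1(3) B2(3) by blast
    ultimately show ?thesis using bd[OF that] by (cases "i \<in> ?B") simp_all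
  qed
  moreover have "?y i = 0" if "i \<notin> {1..n}" for i
  proof -
    have "i \<notin> ?B" using that BA(3) by blast
    thus ?thesis using x that by (simp add: cut_points_def)
  qed
  ultimately have "?y \<in> cut_points n k r c t" unfolding cut_points_def using s1 s2 by blast
  with B show ?thesis by (rule that)
qed

lemma finite_cut_bases: "finite (cut_bases n k r c)"
  by (rule finite_subset[of _ "Pow {1..n}"]) (auto simp: cut_bases_def)

text \<open>Peeling off one basis per unit of \<open>t\<close> writes \<open>x\<close> as a sum of
  \<open>t\<close> indicator vectors; the weight of a basis is its multiplicity.\<close>

lemma cut_points_decompose:
  assumes "k \<le> n"
  shows "x \<in> cut_points n k r c t \<Longrightarrow> \<exists>w :: nat set \<Rightarrow> real. (\<forall>B\<in>cut_bases n k r c. w B \<ge> 0) \<and>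
     (\<Sum>B\<in>cut_bases n k r c. w B) = real t \<and>
     (\<forall>i\<in>{1..n}. real_of_int (x i) = (\<Sum>B\<in>cut_bases n k r c. (if i \<in> B then w B else 0)))"
proof (induction t arbitrary: x)
  case 0
  hence "\<forall>i\<in>{1..n}. x i = 0" by (auto simp: cut_points_def)
  thus ?case by (intro exI[of _ "\<lambda>_. 0"]) auto
next
  case (Suc t)
  obtain B where B: "B \<in> cut_bases n k r c" "(\<lambda>i. x i - (if i \<in> B then 1 else 0)) \<in> cut_points n k r c t"
    using peel_basis[OF Suc.prems assms] .
  from Suc.IH[OF B(2)] obtain w :: "nat set \<Rightarrow> real" where w: "\<forall>B\<in>cut_bases n k r c. w B \<ge> 0"
     "(\<Sum>B\<in>cut_bases n k r c. w B) = real t"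
     "\<forall>i\<in>{1..n}. real_of_int (x i - (if i \<in> B then 1 else 0)) = (\<Sum>B\<in>cut_bases n k r c. (if i \<in> B then w B else 0))"
    by blast
  let ?w = "\<lambda>C. w C + (if C = B then 1 else 0)"
  have "(\<Sum>C\<in>cut_bases n k r c. ?w C) = real (Suc t)"
    using w(2) B(1) finite_cut_bases by (simp add: sum.distrib)
  moreover have "real_of_int (x i) = (\<Sum>C\<in>cut_bases n k r c. (if i \<in> C then ?w C else 0))" if "i \<in> {1..n}" for i
  proof -
    have "(\<Sum>C\<in>cut_bases n k r c. (if i \<in> C then ?w C else 0))
      = (\<Sum>C\<in>cut_bases n k r c. (if i \<in> C then w C else 0) + (if C = B then (if i \<in> B then 1 else 0) else 0))"
      by (intro sum.cong) auto
    also have "\<dots> = (\<Sum>C\<in>cut_bases n k r c. (if i \<in> C then w C else 0)) + (if i \<in> B then 1 else 0)"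
      using B(1) finite_cut_bases by (simp add: sum.distrib)
    finally have "(\<Sum>C\<in>cut_bases n k r c. (if i \<in> C then ?w C else 0))
      = real_of_int (x i - (if i \<in> B then 1 else 0)) + (if i \<in> B then 1 else 0)" using w(3) that by simp
    thus ?thesis by simp
  qed
  ultimately show ?case using w(1) by (intro exI[of _ ?w]) auto
qed

lemma dilate_lattice_points_cut:
  assumes "k \<le> n"
  shows "dilate_lattice_points n (cut_bases n k r c) t = cut_points n k r c t"
proof (intro equalityI subsetI)
  fix x assume "x \<in> cut_points n k r c t"
  thus "x \<in> dilate_lattice_points n (cut_bases n k r c) t"
    using cut_points_decompose[OF assms, of x r c t] by (auto simp: dilate_lattice_points_def cut_points_def)
next
  fix x assume "x \<in> dilate_lattice_points n (cut_bases n k r c) t"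
  then obtain w where zero: "\<forall>i. i \<notin> {1..n} \<longrightarrow> x i = 0" and w: "\<forall>B\<in>cut_bases n k r c. w B \<ge> 0"
     "(\<Sum>B\<in>cut_bases n k r c. w B) = real t"
     "\<forall>i\<in>{1..n}. real_of_int (x i) = (\<Sum>B\<in>cut_bases n k r c. (if i \<in> B then w B else 0))"
    unfolding dilate_lattice_points_def by blast
  \<comment> \<open>Prefix sums of \<open>x\<close> are weighted sums of prefix counts of bases, so
    the rank and the cut carry over to points.\<close>
  have s: "real_of_int (sum x {1..m}) = (\<Sum>B\<in>cut_bases n k r c. w B * real (card (B \<inter> {1..m})))" if "m \<le> n" for m
  proof -
    have "real_of_int (sum x {1..m}) = (\<Sum>i\<in>{1..m}. \<Sum>B\<in>cut_bases n k r c. (if i \<in> B then w B else 0))"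
      using w(3) that by simp
    also have "\<dots> = (\<Sum>B\<in>cut_bases n k r c. \<Sum>i\<in>{1..m}. (if i \<in> B then w B else 0))" by (rule sum.swap)
    also have "\<dots> = (\<Sum>B\<in>cut_bases n k r c. w B * real (card (B \<inter> {1..m})))"
    proof (rule sum.cong[OF refl])
      fix B
      have "(\<Sum>i\<in>{1..m}. (if i \<in> B then w B else 0)) = (\<Sum>i\<in>B \<inter> {1..m}. w B)"
        by (intro sum.mono_neutral_cong_right) auto
      thus "(\<Sum>i\<in>{1..m}. (if i \<in> B then w B else 0)) = w B * real (card (B \<inter> {1..m}))" by simp
    qed
    finally show ?thesis .
  qed
  have "real_of_int (sum x {1..n}) = (\<Sum>B\<in>cut_bases n k r c. w B * real r)"
    unfolding s[OF order_refl] by (intro sum.cong refl) (auto simp: cut_bases_def Int_absorb2)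
  also have "\<dots> = real_of_int (int (r * t))" using w(2) by (simp add: sum_distrib_right[symmetric])
  finally have 1: "sum x {1..n} = int (r * t)" by (simp only: of_int_eq_iff)
  have "real_of_int (int (c * t)) = (\<Sum>B\<in>cut_bases n k r c. w B * real c)"
    using w(2) by (simp add: sum_distrib_right[symmetric])
  also have "\<dots> \<le> real_of_int (sum x {1..k})"
    unfolding s[OF assms]
  proof (intro sum_mono mult_left_mono)
    fix B assume B: "B \<in> cut_bases n k r c"
    show "real c \<le> real (card (B \<inter> {1..k}))"
      using B unfolding cut_bases_inter[OF B, symmetric] by (simp add: cut_bases_def)
    show "0 \<le> w B" using w(1) B by blast
  qed
  finally have 2: "int (c * t) \<le> sum x {1..k}" by (simp only: of_int_le_iff)
  have "0 \<le> x i \<and> x i \<le> int t" if "i \<in> {1..n}" for i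
  proof -
    have "real_of_int (x i) \<ge> 0" using w(1,3) that by (auto intro!: sum_nonneg)
    moreover have "real_of_int (x i) \<le> (\<Sum>B\<in>cut_bases n k r c. w B)"
      using w(1,3) that by (auto intro!: sum_mono)
    ultimately show ?thesis using w(2) by linarith
  qed
  thus "x \<in> cut_points n k r c t" unfolding cut_points_def using 1 2 zero by blast
qed

lemma ehrhart_poly_eqI:
  assumes "\<And>t :: nat. poly p (real t) = real (card (dilate_lattice_points n \<B> t))"
  shows "ehrhart_poly n \<B> = p"
  unfolding ehrhart_poly_def
proof (rule the_equality)
  fix q assume q: "\<forall>t::nat. poly q (real t) = real (card (dilate_lattice_points n \<B> t))"
  have "range real \<subseteq> {x. poly (q - p) x = 0}" using q assms by auto
  moreover have "infinite (range real)" by (simp add: range_inj_infinite inj_of_nat)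
  ultimately have "infinite {x. poly (q - p) x = 0}" using finite_subset by blast
  thus "q = p" using poly_roots_finite[of "q - p"] by auto
qed (use assms in auto)

section \<open>Ehrhart polynomials\<close>

lemma cut_points_eq:
  "cut_points n k r c t = {x \<in> slice {1..n} t (r * t). int (c * t) \<le> sum x {1..k}}"
  by (auto simp: cut_points_def slice_def boxed_def)

text \<open>In both uses one of \<open>f\<close> and \<open>g\<close> is the identity and the other
  the reflection of \<open>cnt_symmetric\<close>, so all counts move to levels
  \<open>u \<le> t\<close>, where \<open>cnt_low\<close> gives binomials.\<close>

lemma card_slice_pairs:
  assumes k: "1 \<le> k" "k < n" and U: "finite U" "\<And>u. u \<in> U \<Longrightarrow> u \<le> t"
    and f: "inj_on f U" "\<And>u. u \<in> U \<Longrightarrow> cnt k t (f u) = cnt k t u"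
    and g: "\<And>u. u \<in> U \<Longrightarrow> cnt (n - k) t (g u) = cnt (n - k) t u"
  shows "real (card (\<Union>u\<in>U. {x \<in> boxed {1..n} t. sum x {1..k} = int (f u) \<and> sum x {Suc k..n} = int (g u)}))
     = (\<Sum>u\<in>U. real (k - 1 + u choose u) * real (n - 1 - 1 - (k - 1) + u choose u))"
proof -
  let ?S = "\<lambda>u. {x \<in> boxed {1..n} t. sum x {1..k} = int (f u) \<and> sum x {Suc k..n} = int (g u)}"
  have un: "{1..n} = {1..k} \<union> {Suc k..n}" using k by auto
  have "card (\<Union>u\<in>U. ?S u) = (\<Sum>u\<in>U. card (?S u))"
  proof (rule card_UN_disjoint)
    show "\<forall>i\<in>U. \<forall>j\<in>U. i \<noteq> j \<longrightarrow> ?S i \<inter> ?S j = {}" using inj_onD[OF f(1)] by fastforce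
  qed (simp_all add: U(1) finite_boxed)
  hence "real (card (\<Union>u\<in>U. ?S u)) = (\<Sum>u\<in>U. real (card (?S u)))" by simp
  also have "\<dots> = (\<Sum>u\<in>U. real (k - 1 + u choose u) * real (n - 1 - 1 - (k - 1) + u choose u))"
  proof (rule sum.cong[OF refl])
    fix u assume u: "u \<in> U"
    have "real (card (?S u)) = cnt k t (f u) * cnt (n - k) t (g u)"
      using card_slice_pair[of "{1..k}" "{Suc k..n}" t "f u" "g u"] unfolding un[symmetric] by simp
    also have "\<dots> = cnt k t u * cnt (n - k) t u" unfolding f(2)[OF u] g[OF u] ..
    also have "cnt k t u = real (k - 1 + u choose u)" using cnt_low[OF U(2)[OF u], of "k - 1"] k by simp
    also have "cnt (n - k) t u = real (n - 1 - 1 - (k - 1) + u choose u)"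
    proof -
      have "n - k = Suc (n - 1 - 1 - (k - 1))" using k by simp
      thus ?thesis using cnt_low[OF U(2)[OF u], of "n - 1 - 1 - (k - 1)"] by simp
    qed
    finally show "real (card (?S u)) = real (k - 1 + u choose u) * real (n - 1 - 1 - (k - 1) + u choose u)" .
  qed
  finally show ?thesis .
qed

lemma sum_split_at:
  fixes x :: "nat \<Rightarrow> int"
  assumes "k \<le> n"
  shows "sum x {1..n} = sum x {1..k} + sum x {Suc k..n}"
proof -
  have "{1..n} = {1..k} \<union> {Suc k..n}" using assms by auto
  thus ?thesis by (simp add: sum.union_disjoint)
qed

lemma card_cut_points_uniform:
  assumes "1 \<le> k" "k \<le> n"
  shows "real (card (cut_points n k k 0 t)) = (\<Sum>m\<le>n - 1. ucoef (n - 1) (k - 1) m * real t ^ m)"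
proof -
  have "cut_points n k k 0 t = slice {1..n} t (k * t)"
    using assms by (auto simp: cut_points_eq slice_def boxed_def intro!: sum_nonneg)
  hence "real (card (cut_points n k k 0 t)) = cnt n t (k * t)" by (simp add: card_slice)
  also have "\<dots> = (\<Sum>m\<le>n - 1. ucoef (n - 1) (k - 1) m * real t ^ m)"
    using cnt_ucoef[of "k - 1" "n - 1" t] assms by simp
  finally show ?thesis .
qed

text \<open>With \<open>u\<close> the sum outside \<open>{1..k}\<close>, the cut condition becomes
  \<open>u \<le> t\<close>.\<close>

lemma card_cut_points_minimal:
  assumes "1 \<le> k" "k < n"
  shows "real (card (cut_points n k k (k - 1) t)) = (\<Sum>m\<le>n - 1. tcoef (n - 1) (k - 1) m * real t ^ m)"
proof -
  have kt: "t \<le> k * t" using assms by simp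
  have "cut_points n k k (k - 1) t
    = (\<Union>u\<in>{..t}. {x \<in> boxed {1..n} t. sum x {1..k} = int (k * t - u) \<and> sum x {Suc k..n} = int u})"
  proof (intro equalityI subsetI)
    fix x assume x: "x \<in> cut_points n k k (k - 1) t"
    define u where "u = nat (sum x {Suc k..n})"
    have "sum x {Suc k..n} \<ge> 0" using x by (intro sum_nonneg) (auto simp: cut_points_def)
    hence u: "sum x {Suc k..n} = int u" by (simp add: u_def)
    have s: "sum x {1..k} + int u = int (k * t)"
      using x sum_split_at[of k n x] assms u by (simp add: cut_points_def)
    have "int ((k - 1) * t) \<le> sum x {1..k}" using x by (simp add: cut_points_def)
    moreover have "(k - 1) * t + t = k * t" using assms by (cases k) auto
    ultimately have ut: "u \<le> t" using s by linarith
    hence "int (k * t - u) = int (k * t) - int u" using kt by (intro of_nat_diff) linarith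
    hence "sum x {1..k} = int (k * t - u)" using s by linarith
    thus "x \<in> (\<Union>u\<in>{..t}. {x \<in> boxed {1..n} t. sum x {1..k} = int (k * t - u) \<and> sum x {Suc k..n} = int u})"
      using u ut x by (auto simp: cut_points_def boxed_def)
  next
    fix x assume "x \<in> (\<Union>u\<in>{..t}. {x \<in> boxed {1..n} t. sum x {1..k} = int (k * t - u) \<and> sum x {Suc k..n} = int u})"
    then obtain u where u: "u \<le> t" "x \<in> boxed {1..n} t" "sum x {1..k} = int (k * t - u)" "sum x {Suc k..n} = int u" by auto
    have "u \<le> k * t" using u kt by linarith
    hence "sum x {1..n} = int (k * t)" using sum_split_at[of k n x] assms u by (simp add: of_nat_diff)
    moreover have "(k - 1) * t \<le> k * t - u" using u assms by (cases k) auto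
    hence "int ((k - 1) * t) \<le> sum x {1..k}" unfolding u(3) by (simp only: of_nat_le_iff)
    ultimately show "x \<in> cut_points n k k (k - 1) t" using u by (auto simp: cut_points_def boxed_def)
  qed
  moreover have "real (card (\<Union>u\<in>{..t}. {x \<in> boxed {1..n} t. sum x {1..k} = int (k * t - u) \<and> sum x {Suc k..n} = int u}))
     = (\<Sum>u\<le>t. real (k - 1 + u choose u) * real (n - 1 - 1 - (k - 1) + u choose u))"
  proof (rule card_slice_pairs)
    show "inj_on (\<lambda>u. k * t - u) {..t}" by (intro inj_onI) (metis atMost_iff diff_diff_cancel kt order_trans)
    fix u assume "u \<in> {..t}"
    hence "u \<le> t" by simp
    hence "u \<le> k * t" using kt by linarith
    thus "cnt k t (k * t - u) = cnt k t u" by (rule cnt_symmetric)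
  qed (use assms in simp_all)
  ultimately show ?thesis using tcoef_sum[of "k - 1" "n - 1" t] assms by simp
qed

text \<open>The points missing from the full slice are those with sum \<open>u < t\<close> on
  \<open>{1..k}\<close>, counted by \<open>tcoef_shift_sum\<close>. Reflection identifies the full
  slice of level \<open>(n - k) * t\<close> with the one of level \<open>k * t\<close>, that of the
  uniform matroid.\<close>

lemma card_cut_points_sp:
  assumes "1 \<le> k" "k < n"
  shows "real (card (cut_points n k (n - k) 1 t))
    = (\<Sum>m\<le>n - 1. (ucoef (n - 1) (k - 1) m - tcoef_shift (n - 1) (k - 1) m) * real t ^ m)"
proof -
  have "1 \<le> n - k" using assms by linarith
  hence nkt: "t \<le> (n - k) * t" by simp
  let ?L = "\<Union>u\<in>{..<t}. {x \<in> boxed {1..n} t. sum x {1..k} = int u \<and> sum x {Suc k..n} = int ((n - k) * t - u)}"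
  have split: "slice {1..n} t ((n - k) * t) = cut_points n k (n - k) 1 t \<union> ?L"
  proof (intro equalityI subsetI)
    fix x assume x: "x \<in> slice {1..n} t ((n - k) * t)"
    define u where "u = nat (sum x {1..k})"
    have "sum x {1..k} \<ge> 0" using x assms by (intro sum_nonneg) (auto simp: slice_def boxed_def)
    hence u: "sum x {1..k} = int u" by (simp add: u_def)
    have s: "int u + sum x {Suc k..n} = int ((n - k) * t)"
      using x sum_split_at[of k n x] assms u by (simp add: slice_def)
    show "x \<in> cut_points n k (n - k) 1 t \<union> ?L"
    proof (cases "t \<le> u")
      case False
      hence "int ((n - k) * t - u) = int ((n - k) * t) - int u" using nkt by (intro of_nat_diff) linarith
      hence "sum x {Suc k..n} = int ((n - k) * t - u)" using s by linarith
      thus ?thesis using False u x by (auto simp: slice_def)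
    qed (use x u in \<open>auto simp: cut_points_eq\<close>)
  next
    fix x assume x: "x \<in> cut_points n k (n - k) 1 t \<union> ?L"
    show "x \<in> slice {1..n} t ((n - k) * t)"
    proof (cases "x \<in> cut_points n k (n - k) 1 t")
      case False
      with x obtain u where u: "u < t" "x \<in> boxed {1..n} t" "sum x {1..k} = int u" "sum x {Suc k..n} = int ((n - k) * t - u)" by auto
      have "u \<le> (n - k) * t" using u nkt by linarith
      thus ?thesis using sum_split_at[of k n x] assms u by (simp add: of_nat_diff slice_def)
    qed (simp add: cut_points_eq)
  qed
  have disj: "cut_points n k (n - k) 1 t \<inter> ?L = {}" by (auto simp: cut_points_def)
  have fin: "finite (cut_points n k (n - k) 1 t)" "finite ?L"
    using finite_slice[of "{1..n}" t "(n - k) * t"] unfolding split by auto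
  have "real (card (slice {1..n} t ((n - k) * t))) = cnt n t (n * t - k * t)"
    by (simp add: card_slice diff_mult_distrib)
  also have "\<dots> = cnt n t (k * t)" using assms by (intro cnt_symmetric) simp
  also have "\<dots> = (\<Sum>m\<le>n - 1. ucoef (n - 1) (k - 1) m * real t ^ m)"
    using cnt_ucoef[of "k - 1" "n - 1" t] assms by simp
  finally have total: "real (card (slice {1..n} t ((n - k) * t))) = (\<Sum>m\<le>n - 1. ucoef (n - 1) (k - 1) m * real t ^ m)" .
  have "real (card ?L) = (\<Sum>u<t. real (k - 1 + u choose u) * real (n - 1 - 1 - (k - 1) + u choose u))"
  proof (rule card_slice_pairs)
    fix u assume "u \<in> {..<t}"
    hence "u < t" by simp
    hence "u \<le> (n - k) * t" using nkt by linarith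
    thus "cnt (n - k) t ((n - k) * t - u) = cnt (n - k) t u" by (rule cnt_symmetric)
  qed (use assms in simp_all)
  also have "\<dots> = (\<Sum>m\<le>n - 1. tcoef_shift (n - 1) (k - 1) m * real t ^ m)"
    using tcoef_shift_sum[of "k - 1" "n - 1" t] assms by simp
  finally have low: "real (card ?L) = (\<Sum>m\<le>n - 1. tcoef_shift (n - 1) (k - 1) m * real t ^ m)" .
  have "real (card (cut_points n k (n - k) 1 t)) + real (card ?L) = real (card (slice {1..n} t ((n - k) * t)))"
    unfolding split card_Un_disjoint[OF fin disj] by simp
  thus ?thesis unfolding total low left_diff_distrib sum_subtractf by (simp only: eq_diff_eq)
qed

lemma coeff_ehrhart_poly:
  assumes "\<And>t :: nat. real (card (dilate_lattice_points n \<B> t)) = (\<Sum>m\<le>N. f m * real t ^ m)"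
  shows "coeff (ehrhart_poly n \<B>) m = (if m \<le> N then f m else 0)"
proof -
  have "ehrhart_poly n \<B> = (\<Sum>m\<le>N. monom (f m) m)"
    by (rule ehrhart_poly_eqI) (simp add: assms poly_sum poly_monom)
  thus ?thesis by (simp add: coeff_sum)
qed

theorem theorem1p6:
  fixes k n :: nat
  assumes "2 \<le> k" and "k + 2 \<le> n"
  shows "(\<forall>m \<le> degree (ehrhart_poly n (schubert_bases n (sp_set k n))).
            coeff (ehrhart_poly n (schubert_bases n (sp_set k n))) m > 0) \<and>
         (\<forall>m. coeff (ehrhart_poly n (schubert_bases n (minimal_set k n))) m
                \<le> coeff (ehrhart_poly n (schubert_bases n (sp_set k n))) m \<and>
              coeff (ehrhart_poly n (schubert_bases n (sp_set k n))) m
                \<le> coeff (ehrhart_poly n (schubert_bases n (uniform_set k n))) m)"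
proof -
  let ?N = "n - 1" and ?j = "k - 1"
  have k: "1 \<le> k" "k \<le> n" "k < n" using assms by auto
  have U: "coeff (ehrhart_poly n (schubert_bases n (uniform_set k n))) m = (if m \<le> ?N then ucoef ?N ?j m else 0)" for m
    unfolding schubert_bases_uniform[OF k(2), of k]
    by (intro coeff_ehrhart_poly) (simp only: dilate_lattice_points_cut[OF k(2)] card_cut_points_uniform[OF k(1,2)])
  have T: "coeff (ehrhart_poly n (schubert_bases n (minimal_set k n))) m = (if m \<le> ?N then tcoef ?N ?j m else 0)" for m
    unfolding schubert_bases_minimal[OF k(1) assms(2)]
    by (intro coeff_ehrhart_poly) (simp only: dilate_lattice_points_cut[OF k(2)] card_cut_points_minimal[OF k(1,3)])
  have S: "coeff (ehrhart_poly n (schubert_bases n (sp_set k n))) m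
      = (if m \<le> ?N then ucoef ?N ?j m - tcoef_shift ?N ?j m else 0)" for m
    unfolding schubert_bases_sp[OF k(1) assms(2)]
    by (intro coeff_ehrhart_poly) (simp only: dilate_lattice_points_cut[OF k(2)] card_cut_points_sp[OF k(1,3)])
  \<comment> \<open>Gives the lower bound and, with \<open>tcoef_pos\<close>, positivity; the upper
    bound is the nonnegativity of \<open>tcoef_shift\<close>.\<close>
  have TS: "tcoef ?N ?j m \<le> ucoef ?N ?j m - tcoef_shift ?N ?j m" for m
  proof -
    have "1 \<le> ?j" "?j + 2 \<le> ?N" using assms by linarith+
    from tcoef_add_shift_le[OF this, of m] show ?thesis by linarith
  qed
  have pos: "0 < ucoef ?N ?j m - tcoef_shift ?N ?j m" if "m \<le> ?N" for m
  proof -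
    have "?j < ?N" using assms by linarith
    from tcoef_pos[OF this that] TS[of m] show ?thesis by linarith
  qed
  have "degree (ehrhart_poly n (schubert_bases n (sp_set k n))) \<le> ?N"
    by (rule degree_le) (simp add: S)
  hence "0 < coeff (ehrhart_poly n (schubert_bases n (sp_set k n))) m"
    if "m \<le> degree (ehrhart_poly n (schubert_bases n (sp_set k n)))" for m
    using pos[of m] that by (simp add: S)
  moreover have "coeff (ehrhart_poly n (schubert_bases n (minimal_set k n))) m
        \<le> coeff (ehrhart_poly n (schubert_bases n (sp_set k n))) m"
    and "coeff (ehrhart_poly n (schubert_bases n (sp_set k n))) m
        \<le> coeff (ehrhart_poly n (schubert_bases n (uniform_set k n))) m" for m
    using TS[of m] tcoef_shift_nonneg[of ?N ?j m] by (simp_all add: U T S)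
  ultimately show ?thesis by blast
qed

end
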